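(* Let $\mathcal{P} \subset \mathbb{R}^d$ be a locally anti-blocking lattice polytope of dimension $d$, and for each $\varepsilon \in \{-1,1\}^d$ let $\mathcal{P}_{\varepsilon} \subset \mathbb{R}^d_{\ge 0}$ be an anti-blocking lattice polytope of dimension $d$ such that $\mathcal{P} \cap \mathbb{R}^d_\varepsilon = \mathcal{P}_{\varepsilon}^\pm \cap \mathbb{R}^d_\varepsilon$. Then $$h^*(\mathcal{P}, x) = \frac{1}{2^{d}}\sum_{\varepsilon \in \{-1,1\}^d} h^*(\mathcal{P}_{\varepsilon}^\pm, x).$$ In particular, $h^*(\mathcal{P},x)$ is $\gamma$-positive if $h^*(\mathcal{P}_{\varepsilon}^{\pm},x)$ is $\gamma$-positive for all $\varepsilon \in \{-1,1\}^d$.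
   Context: A lattice polytope is a convex polytope whose vertices lie in $\mathbb{Z}^d$. A lattice polytope $\mathcal{P}\subset\mathbb{R}^d_{\ge0}$ of dimension $d$ is anti-blocking if whenever $\mathbf{y}\in\mathcal{P}$ and $\mathbf{x}\in\mathbb{R}^d$ with $0\le x_i\le y_i$ for all $i$, then $\mathbf{x}\in\mathcal{P}$. For $\varepsilon\in\{-1,1\}^d$ and $\mathbf{x}\in\mathbb{R}^d$ write $\varepsilon\mathbf{x}=(\varepsilon_1x_1,\dots,\varepsilon_dx_d)$, and for an anti-blocking $\mathcal{P}$ put $\mathcal{P}^\pm=\{\varepsilon\mathbf{x}:\varepsilon\in\{-1,1\}^d,\ \mathbf{x}\in\mathcal{P}\}$ (a lattice polytope). Let $\mathbb{R}^d_\varepsilon=\{\mathbf{x}\in\mathbb{R}^d: \varepsilon_ix_i\ge0 \text{ for all } i\}$. A lattice polytope $\mathcal{P}\subset\mathbb{R}^d$ of dimension $d$ is locally anti-blocking if for each $\varepsilon\in\{-1,1\}^d$ there exists an anti-blocking lattice polytope $\mathcal{P}_\varepsilon\subset\mathbb{R}^d_{\ge0}$ of dimension $d$ with $\mathcal{P}\cap\mathbb{R}^d_\varepsilon=\mathcal{P}_\varepsilon^\pm\cap\mathbb{R}^d_\varepsilon$. For a lattice polytope $\mathcal{Q}\subset\mathbb{R}^n$ of dimension $k$, its $h^*$-polynomial is defined by $1+\sum_{m\ge1}|m\mathcal{Q}\cap\mathbb{Z}^n|x^m = h^*(\mathcal{Q},x)/(1-x)^{k+1}$. A polynomial $f$ of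 degree $d$ is $\gamma$-positive if it is palindromic ($f(x)=x^df(1/x)$) and $f(x)=\sum_{i=0}^{\lfloor d/2\rfloor}\gamma_i x^i(1+x)^{d-2i}$ with all $\gamma_i\ge0$. *)

theory Defs
  imports "HOL-Analysis.Analysis" "HOL-Computational_Algebra.Polynomial_FPS"
begin

unbundle no fps_syntax

definition integer_points :: "(real ^ 'n) set" where
  "integer_points = {x. \<forall>i. x $ i \<in> \<int>}"

definition lattice_polytope :: "(real ^ 'n) set \<Rightarrow> bool" where
  "lattice_polytope P \<longleftrightarrow> polytope P \<and> (\<forall>v. v extreme_point_of P \<longrightarrow> v \<in> integer_points)"

definition full_dimensional :: "(real ^ 'n) set \<Rightarrow> bool" where
  "full_dimensional P \<longleftrightarrow> aff_dim P = int CARD('n)"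

definition anti_blocking :: "(real ^ 'n) set \<Rightarrow> bool" where
  "anti_blocking P \<longleftrightarrow>
     lattice_polytope P \<and> full_dimensional P \<and> P \<subseteq> {x. \<forall>i. 0 \<le> x $ i} \<and>
     (\<forall>y\<in>P. \<forall>x. (\<forall>i. 0 \<le> x $ i \<and> x $ i \<le> y $ i) \<longrightarrow> x \<in> P)"

definition signs :: "(real ^ 'n) set" where
  "signs = {\<epsilon>. \<forall>i. \<epsilon> $ i \<in> {-1, 1}}"

definition sign_act :: "real ^ 'n \<Rightarrow> real ^ 'n \<Rightarrow> real ^ 'n" where
  "sign_act \<epsilon> x = (\<chi> i. \<epsilon> $ i * x $ i)"

definition sym_hull :: "(real ^ 'n) set \<Rightarrow> (real ^ 'n) set"  ("_\<^sup>\<plusminus>" [1000] 999) where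
  "P\<^sup>\<plusminus> = {sign_act \<epsilon> x | \<epsilon> x. \<epsilon> \<in> signs \<and> x \<in> P}"

definition orthant :: "real ^ 'n \<Rightarrow> (real ^ 'n) set" where
  "orthant \<epsilon> = {x. \<forall>i. 0 \<le> \<epsilon> $ i * x $ i}"

definition locally_anti_blocking :: "(real ^ 'n) set \<Rightarrow> bool" where
  "locally_anti_blocking P \<longleftrightarrow>
     lattice_polytope P \<and> full_dimensional P \<and>
     (\<forall>\<epsilon>\<in>signs. \<exists>Q. anti_blocking Q \<and> P \<inter> orthant \<epsilon> = Q\<^sup>\<plusminus> \<inter> orthant \<epsilon>)"

definition ehrhart_series :: "(real ^ 'n) set \<Rightarrow> real fps" where
  "ehrhart_series Q =
     Abs_fps (\<lambda>m. if m = 0 then 1 else real (card ((\<lambda>x. real m *\<^sub>R x) ` Q \<inter> integer_points)))"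

text \<open>
  The polynomial below is unique, and for a nonempty lattice polytope it exists by Ehrhart's theorem.
\<close>

definition h_star :: "(real ^ 'n) set \<Rightarrow> real poly" where
  "h_star Q =
     (THE h. ehrhart_series Q = fps_of_poly h / (1 - fps_X) ^ (nat (aff_dim Q) + 1))"

text \<open>
  For \<open>d = degree f\<close>, \<^term>\<open>reflect_poly f\<close> is $x^d f(1/x)$, and \<open>[:1, 1:]\<close> is $1 + x$.
\<close>

definition gamma_positive :: "real poly \<Rightarrow> bool" where
  "gamma_positive f \<longleftrightarrow>
     reflect_poly f = f \<and>
     (\<exists>\<gamma> :: nat \<Rightarrow> real.
        (\<forall>i \<le> degree f div 2. 0 \<le> \<gamma> i) \<and>
        f = (\<Sum>i \<le> degree f div 2. smult (\<gamma> i) (monom 1 i * [:1, 1:] ^ (degree f - 2 * i))))"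

end

theory Submission
  imports Defs
begin

text \<open>
  Lift a lattice polytope to height one and triangulate the cone over it regularly: for generic costs
  the optimal bases of the associated linear program cover each generic point exactly once.
  Perturbing all points towards a generic point \<open>q\<close> of the cone turns this into a disjoint
  decomposition into half-open simplicial cones, so that the Ehrhart series times \<open>(1 - x)^(d + 1)\<close>
  is the sum of the height generating functions of half-open parallelepipeds. All heights are at most
  \<open>d\<close>, and if the origin is interior then the reflection of its lift in the parallelepiped
  containing it has height exactly \<open>d\<close>. Hence every \<open>h\<^sup>*\<close>-polynomial of a
  polytope \<open>P\<^sub>\<epsilon>\<^sup>\<plusminus>\<close> exists and has degree \<open>d\<close>, which makes the average
  of \<open>\<gamma>\<close>-positive polynomials \<open>\<gamma>\<close>-positive. The averaging formula itself comes from
  counting lattice points orthant by orthant.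
\<close>

section \<open>Regular triangulations\<close>

text \<open>Each \<open>f\<close> gives a nonzero linear functional of the weights. Raising one
  weight by a small \<open>e\<close> makes the new functional nonzero and keeps the earlier ones
  nonzero. This yields both the generic costs and the generic point of the cone.\<close>

lemma generic_weights:
  fixes F :: "('a \<Rightarrow> real) set"
  assumes "finite W" "finite F" "\<And>f. f \<in> F \<Longrightarrow> \<exists>w\<in>W. f w \<noteq> 0"
  shows "\<exists>c. (\<forall>w. 0 < c w) \<and> (\<forall>f\<in>F. (\<Sum>w\<in>W. c w * f w) \<noteq> (0::real))"
  using assms(2,3)
proof (induction F rule: finite_induct)
  case empty
  show ?case by (rule exI[of _ "\<lambda>_. 1"]) auto
next
  case (insert f F)
  then obtain c where c: "\<And>w. 0 < c w" "\<And>g. g \<in> F \<Longrightarrow> (\<Sum>w\<in>W. c w * g w) \<noteq> 0"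
    by blast
  obtain w where w: "w \<in> W" "f w \<noteq> 0" using insert.prems by blast
  define c' where "c' e = (\<lambda>v. c v + (if v = w then e else 0))" for e :: real
  have sum_c': "(\<Sum>v\<in>W. c' e v * g v) = (\<Sum>v\<in>W. c v * g v) + e * g w" for e g
  proof -
    have "(\<Sum>v\<in>W. c' e v * g v) = (\<Sum>v\<in>W. c v * g v + (if v = w then e * g v else 0))"
      by (intro sum.cong) (auto simp: c'_def algebra_simps)
    then show ?thesis using w \<open>finite W\<close> by (simp add: sum.distrib)
  qed
  have ev: "\<forall>\<^sub>F e in at_right (0::real). (\<Sum>v\<in>W. c v * g v) + e * g w \<noteq> 0"
    if "g \<in> insert f F" for g
  proof (cases "(\<Sum>v\<in>W. c v * g v) = 0")
    case True
    then have "g = f" using that c(2) by blast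
    then show ?thesis using True w
      by (auto simp: eventually_at_filter)
  next
    case False
    have "((\<lambda>e. (\<Sum>v\<in>W. c v * g v) + e * g w) \<longlongrightarrow> (\<Sum>v\<in>W. c v * g v) + 0 * g w) (at_right 0)"
      by (intro tendsto_intros)
    then show ?thesis using False tendsto_imp_eventually_ne by fastforce
  qed
  have "\<forall>\<^sub>F e in at_right (0::real). (\<forall>g\<in>insert f F. (\<Sum>v\<in>W. c v * g v) + e * g w \<noteq> 0) \<and> 0 < e"
    using ev insert.hyps(1)
    by (intro eventually_conj eventually_ball_finite) (auto simp: eventually_at_right_less)
  then obtain e where "0 < e" "\<And>g. g \<in> insert f F \<Longrightarrow> (\<Sum>v\<in>W. c v * g v) + e * g w \<noteq> 0"
    by (smt (verit) eventually_happens trivial_limit_at_right_real)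
  then show ?case
    using c(1) by (intro exI[of _ "c' e"]) (simp add: sum_c', simp add: c'_def add_pos_pos)
qed

section \<open>Cones over points at height one, and their bases\<close>

locale graded_cone =
  fixes W :: "'a::euclidean_space set" and ht :: "'a \<Rightarrow> real"
  assumes finite_W: "finite W" and span_W: "span W = UNIV"
    and linear_ht: "linear ht" and ht_W: "\<And>w. w \<in> W \<Longrightarrow> ht w = 1"
begin

definition bases :: "'a set set" where
  "bases = {\<sigma>. \<sigma> \<subseteq> W \<and> independent \<sigma> \<and> span \<sigma> = UNIV}"

definition Cone :: "'a set" where
  "Cone = {x. \<exists>u. (\<forall>w\<in>W. 0 \<le> u w) \<and> x = (\<Sum>w\<in>W. u w *\<^sub>R w)}"

text \<open>The linear function that agrees with \<open>c\<close> on the basis \<sigma>;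
  \<open>c j - price c \<sigma> j\<close> is the reduced cost of \<open>j\<close>.\<close>

definition price :: "('a \<Rightarrow> real) \<Rightarrow> 'a set \<Rightarrow> 'a \<Rightarrow> real" where
  "price c \<sigma> x = (\<Sum>w\<in>\<sigma>. representation \<sigma> x w * c w)"

text \<open>Such a point avoids every hyperplane spanned by all but one vector of a basis.\<close>

definition generic :: "'a \<Rightarrow> bool" where
  "generic z \<longleftrightarrow> (\<forall>\<sigma>\<in>bases. \<forall>w\<in>\<sigma>. representation \<sigma> z w \<noteq> 0)"

text \<open>Dual nondegeneracy: no reduced cost vanishes, so the induced subdivision is a
  triangulation.\<close>

definition regular :: "('a \<Rightarrow> real) \<Rightarrow> bool" where
  "regular c \<longleftrightarrow> (\<forall>\<sigma>\<in>bases. \<forall>j\<in>W - \<sigma>. price c \<sigma> j \<noteq> c j)"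

text \<open>
  The optimal bases of the linear program that minimizes \<open>\<Sum>w\<in>W. c w * u w\<close> over all
  nonnegative representations \<open>u\<close> of a vector; they are the maximal cones of the regular
  triangulation induced by the heights \<open>c\<close>.
\<close>

definition regular_triangulation :: "('a \<Rightarrow> real) \<Rightarrow> 'a set set" where
  "regular_triangulation c = {\<sigma>\<in>bases. \<forall>j\<in>W - \<sigma>. price c \<sigma> j < c j}"

lemma finite_bases: "finite bases"
  by (rule finite_subset[of _ "Pow W"]) (auto simp: bases_def finite_W)

lemma triangulation_bases: "\<sigma> \<in> regular_triangulation c \<Longrightarrow> \<sigma> \<in> bases"
  by (simp add: regular_triangulation_def)

lemma
  assumes "\<sigma> \<in> bases"
  shows bases_subset: "\<sigma> \<subseteq> W" and finite_basis: "finite \<sigma>"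
    and independent_basis: "independent \<sigma>" and span_basis: "span \<sigma> = UNIV"
    and card_basis: "card \<sigma> = DIM('a)"
    and sum_representation: "(\<Sum>w\<in>\<sigma>. representation \<sigma> x w *\<^sub>R w) = x"
proof -
  show 1: "\<sigma> \<subseteq> W" "independent \<sigma>" "span \<sigma> = UNIV" using assms by (auto simp: bases_def)
  then show 2: "finite \<sigma>" using finite_W finite_subset by blast
  show "card \<sigma> = DIM('a)" using 1 dim_UNIV dim_span_eq_card_independent by metis
  show "(\<Sum>w\<in>\<sigma>. representation \<sigma> x w *\<^sub>R w) = x"
    using 1 2 by (intro real_vector.sum_representation_eq) auto
qed

lemma linear_representation:
  assumes "\<sigma> \<in> bases"
  shows "linear (\<lambda>x. representation \<sigma> x w)"
  using span_basis[OF assms] independent_basis[OF assms]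
  by (intro linearI) (auto simp: real_vector.representation_add real_vector.representation_scale)

lemma linear_price: "\<sigma> \<in> bases \<Longrightarrow> linear (price c \<sigma>)"
  unfolding price_def
  by (intro linearI)
     (auto simp: linear_add[OF linear_representation] linear_scale[OF linear_representation]
        algebra_simps sum.distrib sum_distrib_left)

lemma representation_self:
  "\<sigma> \<in> bases \<Longrightarrow> v \<in> \<sigma> \<Longrightarrow> representation \<sigma> v w = (if w = v then 1 else 0)"
  by (simp add: independent_basis real_vector.representation_basis)

lemma representation_sum:
  assumes "\<sigma> \<in> bases" "w \<in> \<sigma>"
  shows "representation \<sigma> (\<Sum>v\<in>\<sigma>. u v *\<^sub>R v) w = u w"
proof -
  have "representation \<sigma> (\<Sum>v\<in>\<sigma>. u v *\<^sub>R v) w = (\<Sum>v\<in>\<sigma>. u v * (if w = v then 1 else 0))"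
    using assms by (simp add: linear_sum[OF linear_representation] linear_scale[OF linear_representation]
      representation_self)
  then show ?thesis using finite_basis[OF assms(1)] assms(2)
    by (simp add: if_distrib cong: if_cong)
qed

lemma price_self:
  assumes "\<sigma> \<in> bases" "w \<in> \<sigma>"
  shows "price c \<sigma> w = c w"
proof -
  have "price c \<sigma> w = (\<Sum>v\<in>\<sigma>. (if v = w then 1 else 0) * c v)"
    unfolding price_def using assms by (intro sum.cong) (auto simp: representation_self)
  then show ?thesis using finite_basis[OF assms(1)] assms(2)
    by (simp add: if_distrib if_distribR cong: if_cong)
qed

lemma ht_eq_sum_representation:
  assumes "\<sigma> \<in> bases"
  shows "ht x = (\<Sum>w\<in>\<sigma>. representation \<sigma> x w)"
proof -
  have "ht x = ht (\<Sum>w\<in>\<sigma>. representation \<sigma> x w *\<^sub>R w)"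
    using assms by (simp add: sum_representation)
  also have "\<dots> = (\<Sum>w\<in>\<sigma>. representation \<sigma> x w * ht w)"
    by (simp add: linear_sum[OF linear_ht] linear_scale[OF linear_ht])
  also have "\<dots> = (\<Sum>w\<in>\<sigma>. representation \<sigma> x w)"
    using bases_subset[OF assms] by (intro sum.cong) (auto simp: ht_W)
  finally show ?thesis .
qed

lemma W_nonempty: "W \<noteq> {}"
proof
  assume "W = {}"
  then have "UNIV = {0::'a}" using span_W by simp
  moreover obtain b :: 'a where "b \<in> Basis" using nonempty_Basis by blast
  ultimately show False using nonzero_Basis by blast
qed

lemma Cone_of_nonneg_representation:
  assumes "\<sigma> \<in> bases" "\<And>w. w \<in> \<sigma> \<Longrightarrow> 0 \<le> representation \<sigma> x w"
  shows "x \<in> Cone"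
proof -
  have "(\<Sum>w\<in>W. representation \<sigma> x w *\<^sub>R w) = x"
    using span_basis[OF assms(1)] independent_basis[OF assms(1)] bases_subset[OF assms(1)] finite_W
    by (intro real_vector.sum_representation_eq) auto
  moreover have "0 \<le> representation \<sigma> x w" for w
    using assms(2) real_vector.representation_ne_zero[of \<sigma> x w] by fastforce
  ultimately show ?thesis unfolding Cone_def by (intro CollectI exI[of _ "representation \<sigma> x"]) auto
qed

text \<open>The coefficients of a conical combination of \<open>W\<close> sum to its height, so at
  height zero all of them vanish.\<close>

lemma ht_Cone:
  assumes "x \<in> Cone"
  shows "0 \<le> ht x" "ht x = 0 \<Longrightarrow> x = 0"
proof -
  obtain u where u: "\<And>w. w \<in> W \<Longrightarrow> 0 \<le> u w" "x = (\<Sum>w\<in>W. u w *\<^sub>R w)"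
    using assms by (auto simp: Cone_def)
  have h: "ht x = (\<Sum>w\<in>W. u w)"
    by (simp add: u(2) linear_sum[OF linear_ht] linear_scale[OF linear_ht] ht_W)
  show "0 \<le> ht x" using h u(1) by (simp add: sum_nonneg)
  show "x = 0" if "ht x = 0"
    using that h u finite_W by (simp add: sum_nonneg_eq_0_iff)
qed

lemma Cone_add:
  assumes "x \<in> Cone" "y \<in> Cone"
  shows "x + y \<in> Cone"
proof -
  obtain u v where "\<And>w. w \<in> W \<Longrightarrow> 0 \<le> u w" "x = (\<Sum>w\<in>W. u w *\<^sub>R w)"
    "\<And>w. w \<in> W \<Longrightarrow> 0 \<le> v w" "y = (\<Sum>w\<in>W. v w *\<^sub>R w)"
    using assms by (auto simp: Cone_def)
  then show ?thesis unfolding Cone_def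
    by (intro CollectI exI[of _ "\<lambda>w. u w + v w"]) (simp add: scaleR_add_left sum.distrib)
qed

lemma Cone_scaleR:
  assumes "x \<in> Cone" "0 \<le> r"
  shows "r *\<^sub>R x \<in> Cone"
proof -
  obtain u where "\<And>w. w \<in> W \<Longrightarrow> 0 \<le> u w" "x = (\<Sum>w\<in>W. u w *\<^sub>R w)"
    using assms by (auto simp: Cone_def)
  then show ?thesis unfolding Cone_def using assms(2)
    by (intro CollectI exI[of _ "\<lambda>w. r * u w"]) (simp add: scaleR_sum_right)
qed

section \<open>Feasible and optimal bases of the linear program\<close>

text \<open>Caratheodory's argument: a conical representation of minimal support has independent
  support, and the vectors that extend it to a basis get coefficient zero. This provides a feasible
  basis.\<close>

lemma caratheodory_generic:
  assumes "z \<in> Cone" "generic z"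
  obtains \<sigma> where "\<sigma> \<in> bases" "\<And>w. w \<in> \<sigma> \<Longrightarrow> 0 \<le> representation \<sigma> z w"
proof -
  define P where "P T \<longleftrightarrow> T \<subseteq> W \<and> (\<exists>u. (\<forall>w\<in>T. 0 \<le> u w) \<and> z = (\<Sum>w\<in>T. u w *\<^sub>R w))" for T
  have "P W" using assms(1) by (simp add: P_def Cone_def)
  then obtain T where "P T" and minT: "\<And>S. P S \<Longrightarrow> card T \<le> card S"
    using exists_least_iff[of "\<lambda>n. \<exists>T. P T \<and> card T = n"] by (metis not_le)
  then obtain u where u: "T \<subseteq> W" "\<And>w. w \<in> T \<Longrightarrow> 0 \<le> u w" "z = (\<Sum>w\<in>T. u w *\<^sub>R w)"
    by (auto simp: P_def)
  have finT: "finite T" using u(1) finite_W finite_subset by blast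
  have "independent T"
  proof
    assume "dependent T"
    then obtain a0 v0 where "v0 \<in> T" "a0 v0 \<noteq> (0::real)" "(\<Sum>w\<in>T. a0 w *\<^sub>R w) = 0"
      using finT by (auto simp: dependent_finite)
    then obtain a v where a: "v \<in> T" "a v > (0::real)" "(\<Sum>w\<in>T. a w *\<^sub>R w) = 0"
    proof (cases "a0 v0 > 0")
      case False
      then show ?thesis using that[of v0 "\<lambda>w. - a0 w"] \<open>v0 \<in> T\<close> \<open>a0 v0 \<noteq> 0\<close> \<open>_ = 0\<close>
        by (simp add: sum_negf)
    qed auto
    \<comment> \<open>Ratio test: the minimal quotient is the largest multiple of the relation
      \<open>a\<close> that can be subtracted with all coefficients staying nonnegative. It removes
      \<open>i\<close> from the support.\<close>
    let ?I = "{w\<in>T. 0 < a w}"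
    have "finite ?I" "?I \<noteq> {}" using a finT by auto
    then obtain i where i: "i \<in> ?I" "\<And>w. w \<in> ?I \<Longrightarrow> u i / a i \<le> u w / a w"
      using ex_is_arg_min_if_finite[of ?I "\<lambda>w. u w / a w"] by (auto simp: is_arg_min_linorder)
    define t where "t = u i / a i"
    have "0 \<le> t" using i(1) u(2) by (simp add: t_def)
    have nn: "0 \<le> u w - t * a w" if "w \<in> T" for w
    proof (cases "0 < a w")
      case True
      then show ?thesis using i(2)[of w] that by (simp add: t_def field_simps)
    next
      case False
      then have "t * a w \<le> 0" using \<open>0 \<le> t\<close> by (simp add: mult_nonneg_nonpos)
      then show ?thesis using u(2)[OF that] by simp
    qed
    have "z = (\<Sum>w\<in>T. u w *\<^sub>R w) - t *\<^sub>R (\<Sum>w\<in>T. a w *\<^sub>R w)" using u(3) a(3) by simp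
    also have "\<dots> = (\<Sum>w\<in>T. (u w - t * a w) *\<^sub>R w)"
      by (simp add: scaleR_diff_left sum_subtractf scaleR_sum_right)
    also have "\<dots> = (\<Sum>w\<in>T - {i}. (u w - t * a w) *\<^sub>R w)"
      using i(1) finT by (subst sum.remove[of T i]) (auto simp: t_def)
    finally have "P (T - {i})"
      using nn u(1) unfolding P_def by (intro conjI exI[of _ "\<lambda>w. u w - t * a w"]) auto
    then have "card T \<le> card (T - {i})" by (rule minT)
    then show False using i(1) finT card_Diff1_less[of T i] by simp
  qed
  then obtain \<sigma> where \<sigma>: "T \<subseteq> \<sigma>" "\<sigma> \<subseteq> W" "independent \<sigma>" "W \<subseteq> span \<sigma>"
    using real_vector.maximal_independent_subset_extend[OF u(1)] by blast
  then have "span \<sigma> = UNIV" using span_W span_mono[of W "span \<sigma>"] by (auto simp: span_span)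
  then have basis: "\<sigma> \<in> bases" using \<sigma> by (simp add: bases_def)
  have "z = (\<Sum>w\<in>\<sigma>. (if w \<in> T then u w else 0) *\<^sub>R w)"
    unfolding u(3) using \<sigma>(1) finite_basis[OF basis] by (intro sum.mono_neutral_cong_left) auto
  then have "representation \<sigma> z w = (if w \<in> T then u w else 0)" if "w \<in> \<sigma>" for w
    using representation_sum[OF basis that] by simp
  then show ?thesis using that[OF basis] u(2) by simp
qed

text \<open>One simplex step: \<open>j\<close> has negative reduced cost and enters, and the ratio
  test picks the vector that leaves. As all coordinates of \<open>z\<close> are positive, the step
  length \<open>t\<close> is positive and the price drops strictly.\<close>

lemma pivot:
  assumes \<sigma>: "\<sigma> \<in> bases" and pos: "\<And>w. w \<in> \<sigma> \<Longrightarrow> 0 < representation \<sigma> z w"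
    and j: "j \<in> W - \<sigma>" and cj: "c j < price c \<sigma> j"
  obtains \<tau> where "\<tau> \<in> bases" "\<And>w. w \<in> \<tau> \<Longrightarrow> 0 \<le> representation \<tau> z w"
    "price c \<tau> z < price c \<sigma> z"
proof -
  define a where "a = representation \<sigma> j"
  define l where "l = representation \<sigma> z"
  note fin = finite_basis[OF \<sigma>]
  \<comment> \<open>All of \<open>W\<close> has height one, so the coordinates of \<open>j\<close>
    sum to one. Hence one of them is positive and a leaving vector exists.\<close>
  have suma: "(\<Sum>w\<in>\<sigma>. a w) = 1"
    using ht_eq_sum_representation[OF \<sigma>, of j] j by (simp add: a_def ht_W)
  have j_eq: "j = (\<Sum>w\<in>\<sigma>. a w *\<^sub>R w)" by (simp add: a_def sum_representation[OF \<sigma>])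
  have z_eq: "z = (\<Sum>w\<in>\<sigma>. l w *\<^sub>R w)" by (simp add: l_def sum_representation[OF \<sigma>])
  let ?I = "{w\<in>\<sigma>. 0 < a w}"
  have "?I \<noteq> {}"
  proof
    assume "?I = {}"
    then have "(\<Sum>w\<in>\<sigma>. a w) \<le> 0" by (intro sum_nonpos) force
    then show False using suma by simp
  qed
  then obtain i where i: "i \<in> ?I" "\<And>w. w \<in> ?I \<Longrightarrow> l i / a i \<le> l w / a w"
    using ex_is_arg_min_if_finite[of ?I "\<lambda>w. l w / a w"] fin by (auto simp: is_arg_min_linorder)
  define t where "t = l i / a i"
  have "0 < t" using i(1) pos by (simp add: t_def l_def)
  define \<tau> where "\<tau> = insert j (\<sigma> - {i})"
  have nn: "0 \<le> l w - t * a w" if "w \<in> \<sigma>" for w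
  proof (cases "0 < a w")
    case True
    then show ?thesis using i(2)[of w] that by (simp add: t_def field_simps)
  next
    case False
    then have "t * a w \<le> 0" using \<open>0 < t\<close> by (simp add: mult_nonneg_nonpos)
    then show ?thesis using pos[OF that] by (simp add: l_def)
  qed
  have "i \<in> span \<tau>"
  proof -
    have "a i *\<^sub>R i = j - (\<Sum>w\<in>\<sigma> - {i}. a w *\<^sub>R w)"
      using i(1) fin by (subst j_eq) (simp add: sum.remove[of \<sigma> i])
    also have "\<dots> \<in> span \<tau>"
      by (intro span_diff span_sum span_scale span_base) (auto simp: \<tau>_def)
    finally have "(1 / a i) *\<^sub>R a i *\<^sub>R i \<in> span \<tau>" by (rule span_scale)
    then show ?thesis using i(1) by simp
  qed
  then have "\<sigma> \<subseteq> span \<tau>" by (auto simp: \<tau>_def intro: span_base)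
  then have span: "span \<tau> = UNIV"
    using span_basis[OF \<sigma>] span_mono[of \<sigma> "span \<tau>"] by (auto simp: span_span)
  have "card \<tau> = card \<sigma>"
    using i(1) j fin card_Suc_Diff1[of \<sigma> i] by (simp add: \<tau>_def card_insert_if)
  then have "independent \<tau>"
    using span fin card_basis[OF \<sigma>] by (intro card_le_dim_spanning[of \<tau> UNIV]) (auto simp: \<tau>_def)
  then have \<tau>: "\<tau> \<in> bases"
    using span bases_subset[OF \<sigma>] j by (auto simp: bases_def \<tau>_def)
  \<comment> \<open>The coordinates of \<open>z\<close> in the new basis; those that remain from
    \<sigma> drop by \<open>t * a w\<close>, which would give zero at \<open>i\<close>. The next
    identity is general in \<open>g\<close> because it is used for the vectors and again for their
    costs.\<close>
  define f where "f = (\<lambda>w. if w = j then t else l w - t * a w)"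
  have sum_f: "(\<Sum>w\<in>\<tau>. f w *\<^sub>R g w) = (\<Sum>w\<in>\<sigma>. l w *\<^sub>R g w) + t *\<^sub>R (g j - (\<Sum>w\<in>\<sigma>. a w *\<^sub>R g w))"
    for g :: "'a \<Rightarrow> 'b::real_vector"
  proof -
    have "(\<Sum>w\<in>\<tau>. f w *\<^sub>R g w) = t *\<^sub>R g j + (\<Sum>w\<in>\<sigma> - {i}. (l w - t * a w) *\<^sub>R g w)"
      using fin j by (simp add: \<tau>_def f_def) (intro sum.cong, auto)
    also have "(\<Sum>w\<in>\<sigma> - {i}. (l w - t * a w) *\<^sub>R g w) = (\<Sum>w\<in>\<sigma>. (l w - t * a w) *\<^sub>R g w)"
      using i(1) fin by (subst sum.remove[of \<sigma> i]) (auto simp: t_def)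
    finally show ?thesis
      by (simp add: algebra_simps sum_subtractf scaleR_sum_right)
  qed
  have "(\<Sum>w\<in>\<tau>. f w *\<^sub>R w) = z"
    using sum_f[of "\<lambda>w. w"] j_eq z_eq by simp
  then have rep: "representation \<tau> z w = f w" if "w \<in> \<tau>" for w
    using representation_sum[OF \<tau> that, of f] by simp
  show ?thesis
  proof
    show "\<tau> \<in> bases" by fact
    show "0 \<le> representation \<tau> z w" if "w \<in> \<tau>" for w
      using rep[OF that] that nn[of w] \<open>0 < t\<close> by (auto simp: f_def \<tau>_def)
    have "price c \<tau> z = (\<Sum>w\<in>\<tau>. f w *\<^sub>R c w)" by (simp add: price_def rep)
    also have "\<dots> = price c \<sigma> z + t * (c j - price c \<sigma> j)"
      using sum_f[of c] by (simp add: price_def l_def a_def)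
    also have "\<dots> < price c \<sigma> z" using \<open>0 < t\<close> cj by (simp add: mult_pos_neg)
    finally show "price c \<tau> z < price c \<sigma> z" .
  qed
qed

text \<open>Take the cheapest of the finitely many feasible bases. Genericity makes the coordinates
  of \<open>z\<close> positive, regularity excludes reduced cost zero, and \<open>pivot\<close>
  excludes negative reduced costs.\<close>

lemma triangulation_covers:
  assumes "regular c" "z \<in> Cone" "generic z"
  obtains \<sigma> where "\<sigma> \<in> regular_triangulation c" "\<And>w. w \<in> \<sigma> \<Longrightarrow> 0 < representation \<sigma> z w"
proof -
  define S where "S = {\<sigma>\<in>bases. \<forall>w\<in>\<sigma>. 0 \<le> representation \<sigma> z w}"
  obtain \<sigma>0 where "\<sigma>0 \<in> bases" "\<And>w. w \<in> \<sigma>0 \<Longrightarrow> 0 \<le> representation \<sigma>0 z w"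
    by (rule caratheodory_generic[OF assms(2,3)]) blast
  then have "S \<noteq> {}" by (auto simp: S_def)
  moreover have "finite S" using finite_bases by (simp add: S_def)
  ultimately obtain \<sigma> where \<sigma>: "\<sigma> \<in> S" "\<And>\<tau>. \<tau> \<in> S \<Longrightarrow> price c \<sigma> z \<le> price c \<tau> z"
    using ex_is_arg_min_if_finite[of S "\<lambda>\<sigma>. price c \<sigma> z"] unfolding is_arg_min_linorder by metis
  then have basis: "\<sigma> \<in> bases" by (simp add: S_def)
  have pos: "0 < representation \<sigma> z w" if "w \<in> \<sigma>" for w
  proof -
    have "0 \<le> representation \<sigma> z w" using \<sigma>(1) that by (simp add: S_def)
    moreover have "representation \<sigma> z w \<noteq> 0" using assms(3) basis that by (simp add: generic_def)
    ultimately show ?thesis by simp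
  qed
  have "price c \<sigma> j < c j" if j: "j \<in> W - \<sigma>" for j
  proof (rule ccontr)
    assume "\<not> price c \<sigma> j < c j"
    then have lt: "c j < price c \<sigma> j"
      using assms(1) basis j unfolding regular_def by force
    obtain \<tau> where "\<tau> \<in> S" "price c \<tau> z < price c \<sigma> z"
      by (rule pivot[of \<sigma> z j c]) (use basis pos j lt in \<open>auto simp: S_def\<close>)
    then show False using \<sigma>(2) by force
  qed
  then show ?thesis using that[of \<sigma>] basis pos by (auto simp: regular_triangulation_def)
qed

text \<open>Linear programming duality: for an optimal basis, \<open>price\<close> is a linear
  function that is at most \<open>c\<close> on \<open>W\<close>, so its value at \<open>z\<close> is
  at most the cost of any other nonnegative representation of \<open>z\<close>. Both bases thus have
  the same price at \<open>z\<close>, and a vector of \<tau> outside \<sigma> would make the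
  inequality strict.\<close>

lemma triangulation_unique:
  assumes \<sigma>: "\<sigma> \<in> regular_triangulation c" "\<And>w. w \<in> \<sigma> \<Longrightarrow> 0 < representation \<sigma> z w"
    and \<tau>: "\<tau> \<in> regular_triangulation c" "\<And>w. w \<in> \<tau> \<Longrightarrow> 0 < representation \<tau> z w"
  shows "\<sigma> = \<tau>"
proof -
  have price_le: "price c \<alpha> w \<le> c w" if "\<alpha> \<in> regular_triangulation c" "w \<in> W" for \<alpha> w
    using that price_self[of \<alpha> w c] by (cases "w \<in> \<alpha>") (auto simp: regular_triangulation_def intro: less_imp_le)
  have expand: "price c \<alpha> z = (\<Sum>w\<in>\<beta>. representation \<beta> z w * price c \<alpha> w)"
    if "\<alpha> \<in> regular_triangulation c" "\<beta> \<in> regular_triangulation c" for \<alpha> \<beta>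
  proof -
    have "price c \<alpha> z = price c \<alpha> (\<Sum>w\<in>\<beta>. representation \<beta> z w *\<^sub>R w)"
      using that by (simp add: sum_representation triangulation_bases)
    then show ?thesis using that
      by (simp add: linear_sum[OF linear_price] linear_scale[OF linear_price] triangulation_bases)
  qed
  have le: "price c \<alpha> z \<le> price c \<beta> z"
    if "\<alpha> \<in> regular_triangulation c" "\<beta> \<in> regular_triangulation c" "\<And>w. w \<in> \<beta> \<Longrightarrow> 0 < representation \<beta> z w" for \<alpha> \<beta>
    unfolding expand[OF that(1,2)] price_def[of c \<beta>]
    using that bases_subset[OF triangulation_bases[OF that(2)]] price_le[OF that(1)]
    by (intro sum_mono mult_left_mono) (auto intro: less_imp_le)
  have "\<tau> \<subseteq> \<sigma>"
  proof
    fix w assume w: "w \<in> \<tau>"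
    show "w \<in> \<sigma>"
    proof (rule ccontr)
      assume "w \<notin> \<sigma>"
      then have lt: "price c \<sigma> w < c w"
        using \<sigma>(1) w bases_subset[OF triangulation_bases[OF \<tau>(1)]] by (auto simp: regular_triangulation_def)
      have "price c \<sigma> z < price c \<tau> z"
        unfolding expand[OF \<sigma>(1) \<tau>(1)] price_def[of c \<tau>]
      proof (rule sum_strict_mono_ex1)
        show "finite \<tau>" using finite_basis triangulation_bases \<tau>(1) by blast
        show "\<forall>v\<in>\<tau>. representation \<tau> z v * price c \<sigma> v \<le> representation \<tau> z v * c v"
          using less_imp_le[OF \<tau>(2)] bases_subset[OF triangulation_bases[OF \<tau>(1)]] price_le[OF \<sigma>(1)]
          by (auto intro!: mult_left_mono)
        show "\<exists>v\<in>\<tau>. representation \<tau> z v * price c \<sigma> v < representation \<tau> z v * c v"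
          using w lt \<tau>(2) by (auto intro!: bexI[of _ w] mult_strict_left_mono)
      qed
      then show False using le[OF \<tau>(1) \<sigma>] by simp
    qed
  qed
  then show ?thesis
    using card_basis finite_basis triangulation_bases[OF \<sigma>(1)] triangulation_bases[OF \<tau>(1)]
    by (metis card_subset_eq)
qed

section \<open>Existence of regular costs and generic points\<close>

text \<open>As a functional of the costs, the reduced cost of \<open>j\<close> has coefficient one
  at \<open>j\<close>, because \<open>j\<close> lies outside \<sigma>. So
  \<open>generic_weights\<close> applies.\<close>

lemma regular_exists: obtains c where "regular c"
proof -
  define f where "f = (\<lambda>(\<sigma>, j :: 'a) w. (if w = j then 1 else 0) - representation \<sigma> j w)"
  let ?I = "SIGMA \<sigma>:bases. W - \<sigma>"
  have off: "representation \<sigma> x w = 0" if "w \<notin> \<sigma>" for \<sigma> and x w :: 'a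
    using real_vector.representation_ne_zero that by blast
  have "finite (f ` ?I)" using finite_bases finite_W by auto
  moreover have "\<exists>w\<in>W. g w \<noteq> 0" if "g \<in> f ` ?I" for g
    using that off by (force simp: f_def)
  ultimately have "\<exists>c. (\<forall>w. 0 < c w) \<and> (\<forall>g\<in>f ` ?I. (\<Sum>w\<in>W. c w * g w) \<noteq> 0)"
    by (rule generic_weights[OF finite_W])
  then obtain c where c: "\<And>g. g \<in> f ` ?I \<Longrightarrow> (\<Sum>w\<in>W. c w * g w) \<noteq> 0"
    by blast
  have "regular c" unfolding regular_def
  proof (intro ballI)
    fix \<sigma> j assume \<sigma>: "\<sigma> \<in> bases" and j: "j \<in> W - \<sigma>"
    have "(\<Sum>w\<in>W. c w * representation \<sigma> j w) = price c \<sigma> j"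
      unfolding price_def using bases_subset[OF \<sigma>] finite_W off
      by (intro sum.mono_neutral_cong_right) (auto simp: mult.commute)
    moreover have "(\<Sum>w\<in>W. c w * f (\<sigma>, j) w) = c j - (\<Sum>w\<in>W. c w * representation \<sigma> j w)"
      using j finite_W
      by (simp add: f_def right_diff_distrib sum_subtractf if_distribR if_distrib[of "(*) _"] cong: if_cong)
    ultimately show "price c \<sigma> j \<noteq> c j" using c[of "f (\<sigma>, j)"] \<sigma> j by auto
  qed
  then show ?thesis using that by blast
qed

text \<open>The coordinate along \<open>w\<close> of a combination of \<open>W\<close> is a
  functional of the weights with coefficient one at \<open>w\<close> itself. Positive weights also
  put \<open>q\<close> into the cone at positive height.\<close>

lemma generic_exists: obtains q where "generic q" "q \<in> Cone" "0 < ht q"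
proof -
  define f where "f = (\<lambda>(\<sigma>, w :: 'a) v. representation \<sigma> v w)"
  let ?I = "SIGMA \<sigma>:bases. \<sigma>"
  have "finite (f ` ?I)" using finite_bases finite_basis by auto
  moreover have "\<exists>w\<in>W. g w \<noteq> 0" if g: "g \<in> f ` ?I" for g
  proof -
    obtain \<sigma> w where "\<sigma> \<in> bases" "w \<in> \<sigma>" "g = f (\<sigma>, w)" using g by auto
    then show ?thesis
      using bases_subset[of \<sigma>] by (intro bexI[of _ w]) (auto simp: f_def representation_self)
  qed
  ultimately have "\<exists>c. (\<forall>w. 0 < c w) \<and> (\<forall>g\<in>f ` ?I. (\<Sum>w\<in>W. c w * g w) \<noteq> 0)"
    by (rule generic_weights[OF finite_W])
  then obtain c where c: "\<And>w. 0 < c w" "\<And>g. g \<in> f ` ?I \<Longrightarrow> (\<Sum>w\<in>W. c w * g w) \<noteq> 0"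
    by blast
  define q where "q = (\<Sum>w\<in>W. c w *\<^sub>R w)"
  show ?thesis
  proof
    show "generic q"
      unfolding generic_def
    proof (intro ballI)
      fix \<sigma> w assume *: "\<sigma> \<in> bases" "w \<in> \<sigma>"
      then have "f (\<sigma>, w) \<in> f ` ?I" by (intro imageI) simp
      from c(2)[OF this] have "(\<Sum>v\<in>W. c v * representation \<sigma> v w) \<noteq> 0"
        by (simp add: f_def)
      then show "representation \<sigma> q w \<noteq> 0"
        using *(1) by (simp add: q_def linear_sum[OF linear_representation] linear_scale[OF linear_representation])
    qed
    show "q \<in> Cone" unfolding Cone_def q_def using less_imp_le[OF c(1)]
      by (intro CollectI exI[of _ c]) auto
    have "ht q = (\<Sum>w\<in>W. c w)"
      by (simp add: q_def linear_sum[OF linear_ht] linear_scale[OF linear_ht] ht_W)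
    then show "0 < ht q" using c(1) W_nonempty finite_W by (simp add: sum_pos)
  qed
qed

end

section \<open>Half-open decompositions\<close>

text \<open>Positivity of \<open>a + e * b\<close> for infinitesimal \<open>e > 0\<close>.\<close>

definition lexpos :: "real \<Rightarrow> real \<Rightarrow> bool" where
  "lexpos a b \<longleftrightarrow> 0 < a \<or> a = 0 \<and> 0 < b"

lemma eventually_lexpos:
  assumes "b \<noteq> 0"
  shows "\<forall>\<^sub>F e in at_right (0::real). a + e * b \<noteq> 0 \<and> (0 < a + e * b \<longleftrightarrow> lexpos a b)"
proof -
  have lim: "((\<lambda>e. a + e * b) \<longlongrightarrow> a + 0 * b) (at_right (0::real))"
    by (intro tendsto_intros)
  consider "0 < a" | "a < 0" | "a = 0" by linarith
  then show ?thesis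
  proof cases
    case 1
    have "\<forall>\<^sub>F e in at_right (0::real). 0 < a + e * b"
      by (rule order_tendstoD(1)[OF lim]) (use 1 in simp)
    then show ?thesis by eventually_elim (use 1 in \<open>simp add: lexpos_def\<close>)
  next
    case 2
    have "\<forall>\<^sub>F e in at_right (0::real). a + e * b < 0"
      by (rule order_tendstoD(2)[OF lim]) (use 2 in simp)
    then show ?thesis by eventually_elim (use 2 in \<open>simp add: lexpos_def\<close>)
  next
    case 3
    have "\<forall>\<^sub>F e in at_right (0::real). 0 < e" by (rule eventually_at_right_less)
    then show ?thesis
      by eventually_elim (use 3 assms in \<open>simp add: lexpos_def zero_less_mult_iff\<close>)
  qed
qed

section \<open>Infinitesimal perturbation towards a generic point\<close>

context graded_cone
begin

text \<open>Only finitely many coordinates are involved, so one small \<open>e\<close> serves all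
  bases at once.\<close>

lemma eventually_generic:
  assumes "generic p"
  shows "\<forall>\<^sub>F e in at_right 0. generic (x + e *\<^sub>R p) \<and>
    (\<forall>\<sigma>\<in>bases. \<forall>w\<in>\<sigma>. 0 < representation \<sigma> (x + e *\<^sub>R p) w \<longleftrightarrow>
       lexpos (representation \<sigma> x w) (representation \<sigma> p w))"
proof -
  have "\<forall>\<^sub>F e in at_right 0. \<forall>\<sigma>\<in>bases. \<forall>w\<in>\<sigma>.
    representation \<sigma> x w + e * representation \<sigma> p w \<noteq> 0 \<and>
    (0 < representation \<sigma> x w + e * representation \<sigma> p w \<longleftrightarrow>
       lexpos (representation \<sigma> x w) (representation \<sigma> p w))"
    using assms
    by (intro eventually_ball_finite finite_bases ballI finite_basis eventually_lexpos)
       (auto simp: generic_def)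
  then show ?thesis
    by eventually_elim
       (simp add: generic_def linear_add[OF linear_representation] linear_scale[OF linear_representation])
qed

text \<open>The cone that contains the perturbed point is the one required. Membership in
  \<open>Cone\<close> is asked of the perturbed points, so that the lemma can also be used with
  \<open>- q\<close>, where the perturbation leads away from \<open>q\<close>.\<close>

lemma halfopen_covers:
  assumes "regular c" "generic p" "\<forall>\<^sub>F e in at_right 0. x + e *\<^sub>R p \<in> Cone"
  obtains \<sigma> where "\<sigma> \<in> regular_triangulation c"
    "\<And>w. w \<in> \<sigma> \<Longrightarrow> lexpos (representation \<sigma> x w) (representation \<sigma> p w)"
proof -
  obtain e where e: "x + e *\<^sub>R p \<in> Cone" "generic (x + e *\<^sub>R p)"
    "\<And>\<sigma> w. \<sigma> \<in> bases \<Longrightarrow> w \<in> \<sigma> \<Longrightarrow> 0 < representation \<sigma> (x + e *\<^sub>R p) w \<longleftrightarrow>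
       lexpos (representation \<sigma> x w) (representation \<sigma> p w)"
    using eventually_happens[OF eventually_conj[OF assms(3) eventually_generic[OF assms(2), of x]]]
    by (auto simp: trivial_limit_at_right_real)
  obtain \<sigma> where "\<sigma> \<in> regular_triangulation c" "\<And>w. w \<in> \<sigma> \<Longrightarrow> 0 < representation \<sigma> (x + e *\<^sub>R p) w"
    using triangulation_covers[OF assms(1) e(1,2)] by metis
  then show ?thesis using that e(3) triangulation_bases by blast
qed

text \<open>For a common small \<open>e\<close>, both conditions become strict positivity of the
  coordinates of the same perturbed point.\<close>

lemma halfopen_unique:
  assumes "generic p"
    and "\<sigma> \<in> regular_triangulation c" "\<And>w. w \<in> \<sigma> \<Longrightarrow> lexpos (representation \<sigma> x w) (representation \<sigma> p w)"
    and "\<tau> \<in> regular_triangulation c" "\<And>w. w \<in> \<tau> \<Longrightarrow> lexpos (representation \<tau> x w) (representation \<tau> p w)"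
  shows "\<sigma> = \<tau>"
proof -
  obtain e where
    "\<And>\<sigma> w. \<sigma> \<in> bases \<Longrightarrow> w \<in> \<sigma> \<Longrightarrow> 0 < representation \<sigma> (x + e *\<^sub>R p) w \<longleftrightarrow>
       lexpos (representation \<sigma> x w) (representation \<sigma> p w)"
    using eventually_happens[OF eventually_generic[OF assms(1), of x]]
    by (auto simp: trivial_limit_at_right_real)
  then show ?thesis
    using assms(2-) triangulation_bases by (intro triangulation_unique[of \<sigma> c "x + e *\<^sub>R p" \<tau>]) blast+
qed

text \<open>Since \<open>card\<close> is zero on infinite sets, this counts points only where the
  levels are finite.\<close>

definition gf :: "'a set \<Rightarrow> real fps" where
  "gf A = Abs_fps (\<lambda>n. real (card {x\<in>A. ht x = real n}))"

end

section \<open>Lattice points of half-open cones and parallelepipeds\<close>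

locale graded_lattice_cone = graded_cone +
  fixes L :: "'a set"
  assumes W_L: "W \<subseteq> L" and L_add: "\<And>x y. x \<in> L \<Longrightarrow> y \<in> L \<Longrightarrow> x + y \<in> L"
    and L_diff: "\<And>x y. x \<in> L \<Longrightarrow> y \<in> L \<Longrightarrow> x - y \<in> L"
    and L_discrete: "\<And>S. bounded S \<Longrightarrow> finite (S \<inter> L)"
begin

text \<open>
  The points whose coordinates along \<open>\<sigma>\<close>, perturbed infinitesimally towards \<open>q\<close>, are positive,
  and less than one outside \<open>T\<close>. For \<open>T = \<sigma>\<close> these are the lattice points of a half-open cone,
  for \<open>T = {}\<close> those of its fundamental parallelepiped.
\<close>

definition halfopen :: "'a \<Rightarrow> 'a set \<Rightarrow> 'a set \<Rightarrow> 'a set" where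
  "halfopen q \<sigma> T = {x\<in>L. \<forall>w\<in>\<sigma>. lexpos (representation \<sigma> x w) (representation \<sigma> q w) \<and>
     (w \<notin> T \<longrightarrow> \<not> lexpos (representation \<sigma> x w - 1) (representation \<sigma> q w))}"

text \<open>The coordinates are nonnegative and sum to the height, which bounds the points of a
  level; discreteness of \<open>L\<close> does the rest.\<close>

lemma finite_halfopen_level:
  assumes "\<sigma> \<in> bases"
  shows "finite {x\<in>halfopen q \<sigma> T. ht x = r}"
proof -
  have "norm x \<le> (\<Sum>w\<in>\<sigma>. r * norm w)" if "x \<in> halfopen q \<sigma> T" "ht x = r" for x
  proof -
    have nn: "0 \<le> representation \<sigma> x w" if "w \<in> \<sigma>" for w
      using that \<open>x \<in> _\<close> by (auto simp: halfopen_def lexpos_def less_imp_le)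
    have le: "representation \<sigma> x w \<le> r" if "w \<in> \<sigma>" for w
      using member_le_sum[of w \<sigma> "representation \<sigma> x"] that nn finite_basis[OF assms]
        ht_eq_sum_representation[OF assms, of x] \<open>ht x = r\<close> by auto
    have "norm x = norm (\<Sum>w\<in>\<sigma>. representation \<sigma> x w *\<^sub>R w)"
      by (simp add: sum_representation[OF assms])
    also have "\<dots> \<le> (\<Sum>w\<in>\<sigma>. r * norm w)"
      using nn le by (intro sum_norm_le) (simp add: mult_right_mono)
    finally show ?thesis .
  qed
  then have "bounded {x\<in>halfopen q \<sigma> T. ht x = r}"
    unfolding bounded_iff by blast
  from L_discrete[OF this] show ?thesis
    by (rule rev_finite_subset) (auto simp: halfopen_def)
qed

lemma ht_halfopen_nonneg:
  "\<sigma> \<in> bases \<Longrightarrow> x \<in> halfopen q \<sigma> T \<Longrightarrow> 0 \<le> ht x"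
  by (auto simp: ht_eq_sum_representation halfopen_def lexpos_def intro!: sum_nonneg)

text \<open>Without the upper bound along \<open>w\<close>, the set is the disjoint union of the
  bounded set and its own translate by \<open>w\<close>. As \<open>w\<close> has height one, this is
  a geometric series in \<open>fps_X\<close>.\<close>

lemma gf_halfopen_insert:
  assumes \<sigma>: "\<sigma> \<in> bases" and w: "w \<in> \<sigma>" "w \<notin> T"
  shows "gf (halfopen q \<sigma> (insert w T)) * (1 - fps_X) = gf (halfopen q \<sigma> T)"
proof (rule fps_ext)
  fix n
  define B where "B = halfopen q \<sigma> (insert w T)"
  have htw: "ht w = 1" using w(1) bases_subset[OF \<sigma>] ht_W by auto
  have wL: "w \<in> L" using w(1) bases_subset[OF \<sigma>] W_L by auto
  have rep: "representation \<sigma> (x + w) v = representation \<sigma> x v + (if v = w then 1 else 0)"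
    "representation \<sigma> (x - w) v = representation \<sigma> x v - (if v = w then 1 else 0)" for x v
    using w(1) by (simp_all add: linear_add[OF linear_representation[OF \<sigma>]]
        linear_diff[OF linear_representation[OF \<sigma>]] representation_self[OF \<sigma>])
  have sub: "halfopen q \<sigma> T \<subseteq> B" by (auto simp: halfopen_def B_def)
  have plus: "x + w \<in> B - halfopen q \<sigma> T" if "x \<in> B" for x
    using that w wL unfolding B_def halfopen_def
    by (auto simp: rep L_add lexpos_def)
  have minus: "x - w \<in> B" if "x \<in> B - halfopen q \<sigma> T" for x
    using that w wL unfolding B_def halfopen_def by (auto simp: rep L_diff)
  have ht: "ht (x + w) = ht x + 1" "ht (x - w) = ht x - 1" for x
    by (simp_all add: linear_add[OF linear_ht] linear_diff[OF linear_ht] htw)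
  have split: "{x\<in>B. ht x = r} = {x\<in>halfopen q \<sigma> T. ht x = r} \<union> (\<lambda>x. x + w) ` {x\<in>B. ht x = r - 1}"
    (is "?l = ?r1 \<union> ?r2") for r
  proof
    show "?l \<subseteq> ?r1 \<union> ?r2"
    proof
      fix x assume x: "x \<in> ?l"
      show "x \<in> ?r1 \<union> ?r2"
      proof (cases "x \<in> halfopen q \<sigma> T")
        case False
        then have "x - w \<in> {x\<in>B. ht x = r - 1}" using minus[of x] x by (simp add: ht)
        then show ?thesis by (intro UnI2 image_eqI[of _ _ "x - w"]) auto
      qed (use x in auto)
    qed
    show "?r1 \<union> ?r2 \<subseteq> ?l" using sub plus by (auto simp: ht)
  qed
  have fin: "finite {x\<in>B. ht x = r}" "finite {x\<in>halfopen q \<sigma> T. ht x = r}" for r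
    unfolding B_def by (rule finite_halfopen_level[OF \<sigma>])+
  have card: "card {x\<in>B. ht x = r} = card {x\<in>halfopen q \<sigma> T. ht x = r} + card {x\<in>B. ht x = r - 1}" for r
  proof -
    have "card {x\<in>B. ht x = r} =
      card {x\<in>halfopen q \<sigma> T. ht x = r} + card ((\<lambda>x. x + w) ` {x\<in>B. ht x = r - 1})"
      unfolding split[of r] using fin plus by (intro card_Un_disjoint) auto
    then show ?thesis by (simp add: card_image)
  qed
  show "fps_nth (gf (halfopen q \<sigma> (insert w T)) * (1 - fps_X)) n = fps_nth (gf (halfopen q \<sigma> T)) n"
  proof (cases n)
    case 0
    \<comment> \<open>The recursion at level zero refers to level \<open>-1\<close>, which is
      empty.\<close>
    have "{x\<in>B. ht x = 0 - 1} = {}" using ht_halfopen_nonneg[OF \<sigma>] unfolding B_def by fastforce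
    then have "card {x\<in>B. ht x = 0 - 1} = 0" by (simp only: card.empty)
    then show ?thesis using card[of 0] 0 by (simp add: gf_def B_def)
  next
    case (Suc m)
    then show ?thesis using card[of "real n"]
      by (simp add: gf_def B_def right_diff_distrib)
  qed
qed

text \<open>Lifting the upper bounds one at a time contributes one factor for each basis
  vector.\<close>

lemma gf_halfopen:
  assumes \<sigma>: "\<sigma> \<in> bases"
  shows "gf (halfopen q \<sigma> \<sigma>) * (1 - fps_X) ^ DIM('a) = gf (halfopen q \<sigma> {})"
proof -
  have "gf (halfopen q \<sigma> T) * (1 - fps_X) ^ card T = gf (halfopen q \<sigma> {})" if "T \<subseteq> \<sigma>" for T
    using finite_subset[OF that finite_basis[OF \<sigma>]] that
  proof (induction T rule: finite_induct)
    case (insert w T)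
    have "gf (halfopen q \<sigma> (insert w T)) * (1 - fps_X) ^ card (insert w T) =
      gf (halfopen q \<sigma> (insert w T)) * (1 - fps_X) * (1 - fps_X) ^ card T"
      using insert.hyps by (simp add: mult.assoc)
    also have "\<dots> = gf (halfopen q \<sigma> T) * (1 - fps_X) ^ card T"
      using insert by (subst gf_halfopen_insert[OF \<sigma>]) auto
    finally show ?case using insert.IH insert.prems by simp
  qed simp
  from this[of \<sigma>] show ?thesis by (simp add: card_basis[OF \<sigma>])
qed

text \<open>By \<open>halfopen_covers\<close> and \<open>halfopen_unique\<close>, the half-open
  cones partition the lattice points of the cone.\<close>

lemma gf_Cone:
  assumes c: "regular c" and q: "generic q" "q \<in> Cone"
  shows "gf (Cone \<inter> L) = (\<Sum>\<sigma>\<in>regular_triangulation c. gf (halfopen q \<sigma> \<sigma>))"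
proof (rule fps_ext)
  fix n
  let ?A = "\<lambda>\<sigma>. {x\<in>halfopen q \<sigma> \<sigma>. ht x = real n}"
  have fin: "finite (regular_triangulation c)"
    by (rule finite_subset[OF _ finite_bases]) (auto simp: regular_triangulation_def)
  have "{x\<in>Cone \<inter> L. ht x = real n} = (\<Union>\<sigma>\<in>regular_triangulation c. ?A \<sigma>)"
  proof (intro subset_antisym subsetI)
    fix x assume x: "x \<in> {x\<in>Cone \<inter> L. ht x = real n}"
    \<comment> \<open>Because \<open>q\<close> lies in the cone, perturbing towards it never leaves
      the cone, so boundary points are covered too.\<close>
    have "\<forall>\<^sub>F e in at_right (0::real). 0 < e" by (rule eventually_at_right_less)
    then have "\<forall>\<^sub>F e in at_right 0. x + e *\<^sub>R q \<in> Cone"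
      by eventually_elim (use x q(2) in \<open>simp add: Cone_add Cone_scaleR\<close>)
    then obtain \<sigma> where "\<sigma> \<in> regular_triangulation c"
      "\<And>w. w \<in> \<sigma> \<Longrightarrow> lexpos (representation \<sigma> x w) (representation \<sigma> q w)"
      using halfopen_covers[OF c q(1)] by metis
    then show "x \<in> (\<Union>\<sigma>\<in>regular_triangulation c. ?A \<sigma>)" using x by (auto simp: halfopen_def)
  next
    fix x assume "x \<in> (\<Union>\<sigma>\<in>regular_triangulation c. ?A \<sigma>)"
    then obtain \<sigma> where \<sigma>: "\<sigma> \<in> regular_triangulation c" "x \<in> ?A \<sigma>" by blast
    then have "x \<in> Cone"
      by (intro Cone_of_nonneg_representation[of \<sigma>]) (auto simp: triangulation_bases halfopen_def lexpos_def)
    then show "x \<in> {x\<in>Cone \<inter> L. ht x = real n}" using \<sigma> by (auto simp: halfopen_def)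
  qed
  moreover have "card (\<Union>\<sigma>\<in>regular_triangulation c. ?A \<sigma>) = (\<Sum>\<sigma>\<in>regular_triangulation c. card (?A \<sigma>))"
  proof (rule card_UN_disjoint[OF fin])
    show "\<forall>\<sigma>\<in>regular_triangulation c. finite (?A \<sigma>)"
      by (auto intro: finite_halfopen_level triangulation_bases)
    show "\<forall>\<sigma>\<in>regular_triangulation c. \<forall>\<tau>\<in>regular_triangulation c. \<sigma> \<noteq> \<tau> \<longrightarrow> ?A \<sigma> \<inter> ?A \<tau> = {}"
    proof (intro ballI impI, rule ccontr)
      fix \<sigma> \<tau> assume *: "\<sigma> \<in> regular_triangulation c" "\<tau> \<in> regular_triangulation c" "\<sigma> \<noteq> \<tau>" "?A \<sigma> \<inter> ?A \<tau> \<noteq> {}"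
      then obtain x where "x \<in> halfopen q \<sigma> \<sigma>" "x \<in> halfopen q \<tau> \<tau>" by blast
      then have "\<sigma> = \<tau>"
        by (intro halfopen_unique[OF q(1) *(1) _ *(2), of x]) (auto simp: halfopen_def)
      then show False using *(3) by blast
    qed
  qed
  ultimately show "fps_nth (gf (Cone \<inter> L)) n = fps_nth (\<Sum>\<sigma>\<in>regular_triangulation c. gf (halfopen q \<sigma> \<sigma>)) n"
    by (simp add: gf_def fps_sum_nth)
qed

section \<open>Heights in the parallelepipeds\<close>

text \<open>All coordinates are at most one. As \<open>ht q\<close> is positive, some coordinate of
  \<open>q\<close> is positive, and there the upper bound is strict.\<close>

lemma ht_box_less:
  assumes \<sigma>: "\<sigma> \<in> bases" and q: "0 < ht q" and x: "x \<in> halfopen q \<sigma> {}"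
  shows "ht x < DIM('a)"
proof -
  obtain w where w: "w \<in> \<sigma>" "0 < representation \<sigma> q w"
    using q sum_nonpos[of \<sigma> "representation \<sigma> q"] by (force simp: ht_eq_sum_representation[OF \<sigma>])
  have "(\<Sum>v\<in>\<sigma>. representation \<sigma> x v) < (\<Sum>v\<in>\<sigma>. 1)"
    using x w finite_basis[OF \<sigma>]
    by (intro sum_strict_mono_ex1) (force simp: halfopen_def lexpos_def)+
  then show ?thesis by (simp add: ht_eq_sum_representation[OF \<sigma>] card_basis[OF \<sigma>])
qed

text \<open>
  The reflection \<open>x \<mapsto> \<Sum>w\<in>\<sigma>. w - x\<close> exchanges the parallelepipeds that are half-open with respect
  to \<open>q\<close> and to \<open>- q\<close>.
\<close>

lemma box_point_of_interior_point:
  assumes c: "regular c" and q: "generic q" "0 < ht q"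
    and u: "u \<in> L" "ht u = 1" "\<forall>\<^sub>F e in at_right 0. u - e *\<^sub>R q \<in> Cone"
  obtains \<sigma> x where "\<sigma> \<in> regular_triangulation c" "x \<in> halfopen q \<sigma> {}" "ht x = real (DIM('a) - 1)"
proof -
  have neg: "representation \<sigma> (- q) w = - representation \<sigma> q w" if "\<sigma> \<in> bases" for \<sigma> w
    by (rule linear_neg[OF linear_representation[OF that]])
  \<comment> \<open>Perturbing \<open>u\<close> towards \<open>- q\<close> selects the cone whose
    reflected parallelepiped is half-open with respect to \<open>q\<close>.\<close>
  have "generic (- q)" using q(1) by (simp add: generic_def neg)
  then obtain \<sigma> where tri: "\<sigma> \<in> regular_triangulation c"
    and lex: "\<And>w. w \<in> \<sigma> \<Longrightarrow> lexpos (representation \<sigma> u w) (representation \<sigma> (- q) w)"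
    using halfopen_covers[OF c, of "- q" u] u(3) by auto
  then have \<sigma>: "\<sigma> \<in> bases" by (simp add: triangulation_bases)
  define a where "a = representation \<sigma> u"
  define b where "b = representation \<sigma> q"
  have ab: "lexpos (a w) (- b w)" if "w \<in> \<sigma>" for w
    using lex[OF that] by (simp add: a_def b_def neg[OF \<sigma>])
  have nn: "0 \<le> a w" if "w \<in> \<sigma>" for w using ab[OF that] by (auto simp: lexpos_def)
  have suma: "(\<Sum>w\<in>\<sigma>. a w) = 1" and sumb: "0 < (\<Sum>w\<in>\<sigma>. b w)"
    using u(2) q(2) by (simp_all add: ht_eq_sum_representation[OF \<sigma>] a_def b_def)
  define x where "x = (\<Sum>w\<in>\<sigma>. (1 - a w) *\<^sub>R w)"
  have x_eq: "x = (\<Sum>w\<in>\<sigma>. w) - u"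
    by (simp add: x_def scaleR_diff_left sum_subtractf a_def sum_representation[OF \<sigma>])
  have rep: "representation \<sigma> x w = 1 - a w" if "w \<in> \<sigma>" for w
    using representation_sum[OF \<sigma> that] by (simp add: x_def)
  have "0 \<in> L" using L_diff[OF u(1) u(1)] by simp
  have "(\<Sum>w\<in>S. w) \<in> L" if "finite S" "S \<subseteq> L" for S
    using that by (induction S rule: finite_induct) (auto simp: \<open>0 \<in> L\<close> L_add)
  then have "x \<in> L"
    unfolding x_eq using bases_subset[OF \<sigma>] W_L finite_basis[OF \<sigma>] u(1) by (intro L_diff) auto
  moreover have "lexpos (1 - a w) (b w)" if w: "w \<in> \<sigma>" for w
  \<comment> \<open>The delicate case: if \<open>a w = 1\<close>, the other coordinates of
    \<open>u\<close> vanish, so \<open>b\<close> is not positive there, and the positive height of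
    \<open>q\<close> forces \<open>0 < b w\<close>.\<close>
  proof (cases "a w = 1")
    case True
    have "b v \<le> 0" if "v \<in> \<sigma> - {w}" for v
    proof -
      have "(\<Sum>v\<in>\<sigma> - {w}. a v) = 0" using suma w True finite_basis[OF \<sigma>] by (simp add: sum.remove[of \<sigma> w])
      then have "a v = 0" using that nn finite_basis[OF \<sigma>] by (subst (asm) sum_nonneg_eq_0_iff) auto
      then show ?thesis using ab[of v] that by (auto simp: lexpos_def)
    qed
    then have "(\<Sum>v\<in>\<sigma> - {w}. b v) \<le> 0" by (intro sum_nonpos) auto
    then have "0 < b w" using sumb w finite_basis[OF \<sigma>] by (simp add: sum.remove[of \<sigma> w])
    then show ?thesis by (simp add: lexpos_def True)
  next
    case False
    have "a w \<le> 1" using member_le_sum[of w \<sigma> a] w nn finite_basis[OF \<sigma>] suma by auto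
    then show ?thesis using False by (simp add: lexpos_def)
  qed
  moreover have "\<not> lexpos (1 - a w - 1) (b w)" if "w \<in> \<sigma>" for w
    using ab[OF that] by (auto simp: lexpos_def)
  ultimately have "x \<in> halfopen q \<sigma> {}" by (simp add: halfopen_def rep b_def[symmetric])
  moreover have "ht x = real (DIM('a) - 1)"
    using suma by (simp add: ht_eq_sum_representation[OF \<sigma>, of x] rep sum_subtractf card_basis[OF \<sigma>]
      of_nat_diff Suc_leI)
  ultimately show ?thesis using that tri by blast
qed

text \<open>The parallelepipeds have no points of height \<open>DIM('a)\<close> or more, so the
  product is a polynomial. The premise makes \<open>u\<close> an interior lattice point of height
  one, whose reflection gives the positive top coefficient; it ranges over all \<open>q\<close>
  because the generic one is chosen inside the proof.\<close>

theorem gf_Cone_polynomial: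
  assumes u: "u \<in> L" "ht u = 1" "\<And>q. \<forall>\<^sub>F e in at_right 0. u - e *\<^sub>R q \<in> Cone"
  obtains h where "gf (Cone \<inter> L) * (1 - fps_X) ^ DIM('a) = fps_of_poly h"
    "degree h \<le> DIM('a) - 1" "0 < coeff h (DIM('a) - 1)"
proof -
  obtain c where c: "regular c" by (rule regular_exists)
  obtain q where q: "generic q" "q \<in> Cone" "0 < ht q" by (rule generic_exists)
  have fin: "finite (regular_triangulation c)"
    by (rule finite_subset[OF _ finite_bases]) (auto simp: regular_triangulation_def)
  define F where "F = (\<Sum>\<sigma>\<in>regular_triangulation c. gf (halfopen q \<sigma> {}))"
  have F: "gf (Cone \<inter> L) * (1 - fps_X) ^ DIM('a) = F"
    unfolding gf_Cone[OF c q(1,2)] F_def sum_distrib_right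
    by (intro sum.cong) (auto simp: gf_halfopen triangulation_bases)
  have nth: "fps_nth F n = (\<Sum>\<sigma>\<in>regular_triangulation c. real (card {x\<in>halfopen q \<sigma> {}. ht x = real n}))" for n
    by (simp add: F_def fps_sum_nth gf_def)
  have zero: "fps_nth F n = 0" if "DIM('a) \<le> n" for n
  proof -
    have "{x\<in>halfopen q \<sigma> {}. ht x = real n} = {}" if "\<sigma> \<in> regular_triangulation c" for \<sigma>
      using ht_box_less[OF triangulation_bases[OF that] q(3)] \<open>DIM('a) \<le> n\<close> by fastforce
    then show ?thesis unfolding nth by (intro sum.neutral ballI) (simp only: card.empty of_nat_0)
  qed
  define h where "h = (\<Sum>n<DIM('a). monom (fps_nth F n) n)"
  have coeff: "coeff h n = fps_nth F n" for n
    using zero[of n] by (simp add: h_def coeff_sum if_distrib cong: if_cong)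
  show ?thesis
  proof
    show "gf (Cone \<inter> L) * (1 - fps_X) ^ DIM('a) = fps_of_poly h"
      unfolding F by (rule fps_ext) (simp add: coeff)
    show "degree h \<le> DIM('a) - 1"
      by (rule degree_le) (use zero in \<open>auto simp: coeff\<close>)
    obtain \<sigma> x where x: "\<sigma> \<in> regular_triangulation c" "x \<in> halfopen q \<sigma> {}" "ht x = real (DIM('a) - 1)"
      by (rule box_point_of_interior_point[OF c q(1,3) u])
    have "0 < card {x\<in>halfopen q \<sigma> {}. ht x = real (DIM('a) - 1)}"
      using finite_halfopen_level[OF triangulation_bases[OF x(1)]] x(2,3) by (auto simp: card_gt_0_iff)
    then show "0 < coeff h (DIM('a) - 1)"
      unfolding coeff nth using x(1) fin by (intro sum_pos2[of _ \<sigma>]) auto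
  qed
qed

end

section \<open>Ehrhart series\<close>

lemma finite_bounded_integer_points:
  fixes S :: "(real ^ 'n) set"
  assumes "bounded S"
  shows "finite (S \<inter> integer_points)"
proof -
  obtain B where B: "\<And>x. x \<in> S \<Longrightarrow> norm x \<le> B" using assms by (auto simp: bounded_iff)
  have "finite (vec_lambda ` (UNIV \<rightarrow>\<^sub>E {k \<in> \<int>. \<bar>k\<bar> \<le> B}) :: (real ^ 'n) set)"
    by (intro finite_imageI finite_PiE finite_abs_int_segment) simp
  then show ?thesis
  proof (rule rev_finite_subset, intro subsetI)
    fix x assume x: "x \<in> S \<inter> integer_points"
    then have "x $ i \<in> {k \<in> \<int>. \<bar>k\<bar> \<le> B}" for i
      using B[of x] component_le_norm_cart[of x i] by (auto simp: integer_points_def)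
    then show "x \<in> vec_lambda ` (UNIV \<rightarrow>\<^sub>E {k \<in> \<int>. \<bar>k\<bar> \<le> B})"
      by (intro image_eqI[of _ _ "vec_nth x"]) auto
  qed
qed

text \<open>Homogenization: the cone over \<open>V\<close> at height one lives in dimension
  \<open>CARD('n) + 1\<close>, and its level \<open>n\<close> is the dilate of \<open>Q\<close> by
  \<open>n\<close>. The interior lattice point of height one is \<open>(0, 1)\<close>.\<close>

theorem ehrhart_interior_lattice_point:
  fixes V :: "(real ^ 'n) set"
  defines "Q \<equiv> convex hull V"
  assumes V: "finite V" "V \<subseteq> integer_points" and int: "0 \<in> interior Q"
  obtains h where "ehrhart_series Q * (1 - fps_X) ^ (CARD('n) + 1) = fps_of_poly h"
    "degree h = CARD('n)" "0 < lead_coeff h"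
proof -
  define W where "W = (\<lambda>v. (v, 1::real)) ` V"
  define L where "L = (integer_points :: (real ^ 'n) set) \<times> (\<int> :: real set)"
  have inj: "inj_on (\<lambda>v. (v, 1::real)) V" by (auto intro: inj_onI)
  have Q0: "0 \<in> Q" using int interior_subset by blast
  \<comment> \<open>If the lifted points lay in a hyperplane through the origin, \<open>Q\<close>
    would lie in an affine hyperplane and have empty interior.\<close>
  have span: "span W = UNIV"
  proof (rule ccontr)
    assume "span W \<noteq> UNIV"
    then obtain p where p: "p \<noteq> 0" "span W \<subseteq> {x. p \<bullet> x = 0}"
      using span_not_univ_subset_hyperplane by blast
    obtain a b where ab: "p = (a, b)" by fastforce
    have "V \<subseteq> {x. a \<bullet> x = - b}"
      using p(2) span_superset[of W] by (force simp: W_def ab inner_prod_def)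
    then have Q: "Q \<subseteq> {x. a \<bullet> x = - b}"
      unfolding Q_def by (intro hull_minimal) (auto simp: convex_hyperplane)
    then have "b = 0" using Q0 by auto
    then have "a \<noteq> 0" using p(1) ab by (auto simp: zero_prod_def)
    then have "interior {x. a \<bullet> x = - b} = {}" by simp
    then show False using int interior_mono[OF Q] by blast
  qed
  interpret graded_lattice_cone W snd L
  proof (intro graded_lattice_cone.intro graded_cone.intro graded_lattice_cone_axioms.intro)
    show "finite W" using V by (simp add: W_def)
    show "span W = UNIV" by fact
    show "linear (snd :: (real ^ 'n) \<times> real \<Rightarrow> real)" by (rule linear_snd)
    show "snd w = 1" if "w \<in> W" for w using that by (auto simp: W_def)
    show "W \<subseteq> L" using V by (auto simp: W_def L_def)
    show "x + y \<in> L" "x - y \<in> L" if "x \<in> L" "y \<in> L" for x y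
      using that by (auto simp: L_def integer_points_def)
  next
    fix S :: "((real ^ 'n) \<times> real) set" assume "bounded S"
    then have b: "bounded (fst ` S)" and "bounded (snd ` S)"
      by (auto intro: bounded_linear_image bounded_linear_fst bounded_linear_snd)
    then obtain B where B: "\<And>t. t \<in> snd ` S \<Longrightarrow> \<bar>t\<bar> \<le> B" by (auto simp: bounded_iff)
    have "finite ((fst ` S \<inter> integer_points) \<times> {t \<in> \<int>. \<bar>t\<bar> \<le> B})"
      by (intro finite_cartesian_product finite_bounded_integer_points b finite_abs_int_segment)
    then show "finite (S \<inter> L)" by (rule rev_finite_subset) (use B in \<open>force simp: L_def\<close>)
  qed
  have Cone_iff: "(x, t) \<in> Cone \<longleftrightarrow> (1 / t) *\<^sub>R x \<in> Q" if "0 < t" for x t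
  proof -
    have "(x, t) \<in> Cone \<longleftrightarrow> (\<exists>u. (\<forall>v\<in>V. 0 \<le> u v) \<and> (x, t) = (\<Sum>v\<in>V. u v *\<^sub>R (v, 1)))"
    proof
      assume "(x, t) \<in> Cone"
      then obtain u where u: "\<And>w. w \<in> W \<Longrightarrow> 0 \<le> u w" "(x, t) = (\<Sum>w\<in>W. u w *\<^sub>R w)"
        unfolding Cone_def by blast
      show "\<exists>u. (\<forall>v\<in>V. 0 \<le> u v) \<and> (x, t) = (\<Sum>v\<in>V. u v *\<^sub>R (v, 1))"
        using u unfolding W_def
        by (intro exI[of _ "\<lambda>v. u (v, 1)"]) (simp add: sum.reindex[OF inj])
    next
      assume "\<exists>u. (\<forall>v\<in>V. 0 \<le> u v) \<and> (x, t) = (\<Sum>v\<in>V. u v *\<^sub>R (v, 1))"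
      then obtain u where "\<And>v. v \<in> V \<Longrightarrow> 0 \<le> u v" "(x, t) = (\<Sum>v\<in>V. u v *\<^sub>R (v, 1))"
        by blast
      then show "(x, t) \<in> Cone" unfolding Cone_def unfolding W_def
        by (intro CollectI exI[of _ "\<lambda>w. u (fst w)"]) (auto simp: sum.reindex[OF inj])
    qed
    also have "\<dots> \<longleftrightarrow> (\<exists>u. (\<forall>v\<in>V. 0 \<le> u v) \<and> x = (\<Sum>v\<in>V. u v *\<^sub>R v) \<and> t = (\<Sum>v\<in>V. u v))"
      by (simp add: prod_eq_iff fst_sum snd_sum)
    also have "\<dots> \<longleftrightarrow> (1 / t) *\<^sub>R x \<in> Q"
    proof
      assume "\<exists>u. (\<forall>v\<in>V. 0 \<le> u v) \<and> x = (\<Sum>v\<in>V. u v *\<^sub>R v) \<and> t = (\<Sum>v\<in>V. u v)"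
      then obtain u where u: "\<And>v. v \<in> V \<Longrightarrow> 0 \<le> u v" "x = (\<Sum>v\<in>V. u v *\<^sub>R v)" "t = (\<Sum>v\<in>V. u v)"
        by blast
      show "(1 / t) *\<^sub>R x \<in> Q"
        unfolding Q_def convex_hull_finite[OF V(1)] using u(1) that
        by (intro CollectI exI[of _ "\<lambda>v. u v / t"])
           (simp add: u(2) scaleR_sum_right flip: sum_divide_distrib u(3))
    next
      assume "(1 / t) *\<^sub>R x \<in> Q"
      then obtain u where u: "\<And>v. v \<in> V \<Longrightarrow> 0 \<le> u v" "(\<Sum>v\<in>V. u v) = 1"
        "(\<Sum>v\<in>V. u v *\<^sub>R v) = (1 / t) *\<^sub>R x"
        unfolding Q_def convex_hull_finite[OF V(1)] by blast
      have "(\<Sum>v\<in>V. (t * u v) *\<^sub>R v) = t *\<^sub>R (\<Sum>v\<in>V. u v *\<^sub>R v)" by (simp add: scaleR_sum_right)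
      then show "\<exists>u. (\<forall>v\<in>V. 0 \<le> u v) \<and> x = (\<Sum>v\<in>V. u v *\<^sub>R v) \<and> t = (\<Sum>v\<in>V. u v)"
        using u that by (intro exI[of _ "\<lambda>v. t * u v"]) (simp flip: sum_distrib_left)
    qed
    finally show ?thesis .
  qed
  have gf_eq: "gf (Cone \<inter> L) = ehrhart_series Q"
  proof (rule fps_ext)
    fix n
    show "fps_nth (gf (Cone \<inter> L)) n = fps_nth (ehrhart_series Q) n"
    proof (cases "n = 0")
      case True
      \<comment> \<open>Only the apex has height zero, which matches the constant term one of the
        Ehrhart series.\<close>
      have "0 \<in> Cone" unfolding Cone_def by (intro CollectI exI[of _ "\<lambda>_. 0"]) simp
      moreover have "0 \<in> L" by (simp add: L_def integer_points_def zero_prod_def)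
      ultimately have "{x \<in> Cone \<inter> L. snd x = 0} = {0}"
        using ht_Cone(2) by fastforce
      then show ?thesis by (simp add: True gf_def ehrhart_series_def)
    next
      case False
      have "{x \<in> Cone \<inter> L. snd x = real n} = (\<lambda>y. (y, real n)) ` ((*\<^sub>R) (real n) ` Q \<inter> integer_points)"
      proof (intro subset_antisym subsetI)
        fix x assume x: "x \<in> {x \<in> Cone \<inter> L. snd x = real n}"
        then obtain y where y: "x = (y, real n)" by (cases x) auto
        then have "(1 / real n) *\<^sub>R y \<in> Q" "y \<in> integer_points"
          using x False Cone_iff[of "real n" y] by (auto simp: L_def)
        then have "y \<in> (*\<^sub>R) (real n) ` Q"
          using False by (intro image_eqI[of _ _ "(1 / real n) *\<^sub>R y"]) auto
        then show "x \<in> (\<lambda>y. (y, real n)) ` ((*\<^sub>R) (real n) ` Q \<inter> integer_points)"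
          using y \<open>y \<in> integer_points\<close> by blast
      next
        fix x assume "x \<in> (\<lambda>y. (y, real n)) ` ((*\<^sub>R) (real n) ` Q \<inter> integer_points)"
        then obtain y where "x = (real n *\<^sub>R y, real n)" "y \<in> Q" "real n *\<^sub>R y \<in> integer_points"
          by auto
        then show "x \<in> {x \<in> Cone \<inter> L. snd x = real n}"
          using False Cone_iff[of "real n" "real n *\<^sub>R y"] by (auto simp: L_def)
      qed
      then show ?thesis
        using False by (simp add: gf_def ehrhart_series_def card_image inj_on_def)
    qed
  qed
  \<comment> \<open>Rescaled to height one, the perturbed points tend to the origin, which is
    interior to \<open>Q\<close>, so they end up inside \<open>Q\<close>.\<close>
  have near: "\<forall>\<^sub>F e in at_right 0. (0, 1) - e *\<^sub>R q \<in> Cone" for q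
  proof -
    obtain a b where q: "q = (a, b)" by fastforce
    have "((\<lambda>e. (1 / (1 - e * b)) *\<^sub>R (- (e *\<^sub>R a))) \<longlongrightarrow> (1 / (1 - 0 * b)) *\<^sub>R (- (0 *\<^sub>R a))) (at_right 0)"
      by (intro tendsto_intros) auto
    then have "((\<lambda>e. (1 / (1 - e * b)) *\<^sub>R (- (e *\<^sub>R a))) \<longlongrightarrow> 0) (at_right 0)" by simp
    then have "\<forall>\<^sub>F e in at_right 0. (1 / (1 - e * b)) *\<^sub>R (- (e *\<^sub>R a)) \<in> interior Q"
      by (rule topological_tendstoD) (use int in auto)
    moreover have "((\<lambda>e. 1 - e * b) \<longlongrightarrow> 1 - 0 * b) (at_right 0)"
      by (intro tendsto_intros)
    then have "\<forall>\<^sub>F e in at_right 0. 0 < 1 - e * b" by (rule order_tendstoD) simp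
    ultimately show ?thesis
    proof eventually_elim
      case (elim e)
      then show ?case using Cone_iff[of "1 - e * b" "- (e *\<^sub>R a)"] interior_subset[of Q]
        by (auto simp: q)
    qed
  qed
  have "(0, 1) \<in> L" by (simp add: L_def integer_points_def)
  then obtain h where h: "gf (Cone \<inter> L) * (1 - fps_X) ^ DIM((real ^ 'n) \<times> real) = fps_of_poly h"
    "degree h \<le> DIM((real ^ 'n) \<times> real) - 1" "0 < coeff h (DIM((real ^ 'n) \<times> real) - 1)"
    by (rule gf_Cone_polynomial[OF _ _ near]) simp
  then have "degree h = CARD('n)" using le_degree[of h "CARD('n)"] by auto
  then show ?thesis using that[of h] h by (simp add: gf_eq)
qed

text \<open>The denominator has constant term one and is a unit among power series, so the defining
  equation has at most one polynomial solution and the description in \<open>h_star\<close> is met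
  by \<open>h\<close>.\<close>

lemma h_star_eqI:
  fixes Q :: "(real ^ 'n) set"
  assumes "full_dimensional Q" "ehrhart_series Q * (1 - fps_X) ^ (CARD('n) + 1) = fps_of_poly h"
  shows "h_star Q = h"
proof -
  define D :: "real fps" where "D = (1 - fps_X) ^ (CARD('n) + 1)"
  have unit: "fps_nth D 0 \<noteq> 0" by (simp add: D_def fps_nth_power_0)
  have "ehrhart_series Q = fps_of_poly g / D \<longleftrightarrow> g = h" for g
  proof -
    have "ehrhart_series Q = fps_of_poly g / D \<longleftrightarrow> ehrhart_series Q * D = fps_of_poly g"
    proof -
      have "inverse D * D = 1" "D \<noteq> 0" using unit by (auto simp: inverse_mult_eq_1)
      then have "fps_of_poly g / D * D = fps_of_poly g"
        by (simp add: fps_divide_unit[OF unit] mult.assoc)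
      then show ?thesis using \<open>D \<noteq> 0\<close> by (metis mult_right_cancel)
    qed
    also have "\<dots> \<longleftrightarrow> g = h"
      using assms(2) by (auto simp: D_def fps_of_poly_eq_iff)
    finally show ?thesis .
  qed
  moreover have "nat (aff_dim Q) + 1 = CARD('n) + 1"
    using assms(1) by (simp add: full_dimensional_def)
  ultimately show ?thesis unfolding h_star_def D_def by (intro the_equality) metis+
qed

section \<open>Orthants and sign changes\<close>

lemma signs_iff_abs: "\<epsilon> \<in> signs \<longleftrightarrow> (\<forall>i. \<bar>\<epsilon> $ i\<bar> = 1)"
proof -
  have "a \<in> {-1, 1} \<longleftrightarrow> \<bar>a\<bar> = 1" for a :: real by auto
  then show ?thesis by (simp only: signs_def mem_Collect_eq)
qed

lemma signs_square: "\<epsilon> \<in> signs \<Longrightarrow> \<epsilon> $ i * \<epsilon> $ i = 1"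
  by (metis signs_iff_abs abs_mult_self_eq mult_1)

lemma card_signs: "card (signs :: (real ^ 'n) set) = 2 ^ CARD('n)"
  and finite_signs: "finite (signs :: (real ^ 'n) set)"
proof -
  have eq: "(signs :: (real ^ 'n) set) = vec_lambda ` (UNIV \<rightarrow>\<^sub>E {-1, 1})"
  proof (intro subset_antisym subsetI)
    fix x :: "real ^ 'n" assume "x \<in> signs"
    then show "x \<in> vec_lambda ` (UNIV \<rightarrow>\<^sub>E {-1, 1})"
      by (intro image_eqI[of _ _ "vec_nth x"]) (auto simp: signs_def)
  qed (auto simp: signs_def)
  have inj: "inj_on (vec_lambda :: _ \<Rightarrow> real ^ 'n) (UNIV \<rightarrow>\<^sub>E {-1, 1})"
    by (intro inj_onI) (auto simp: vec_lambda_inject)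
  show "card (signs :: (real ^ 'n) set) = 2 ^ CARD('n)"
    unfolding eq card_image[OF inj] by (simp add: card_PiE numeral_2_eq_2)
  show "finite (signs :: (real ^ 'n) set)"
    unfolding eq by (intro finite_imageI finite_PiE) auto
qed

lemma sign_act_self: "\<delta> \<in> signs \<Longrightarrow> sign_act \<delta> (sign_act \<delta> x) = x"
  by (simp add: sign_act_def vec_eq_iff signs_square flip: mult.assoc)

lemma sign_act_signs: "\<delta> \<in> signs \<Longrightarrow> \<epsilon> \<in> signs \<Longrightarrow> sign_act \<delta> \<epsilon> \<in> signs"
  by (simp add: sign_act_def signs_iff_abs abs_mult)

lemma sign_act_commute: "sign_act \<delta> \<epsilon> = sign_act \<epsilon> \<delta>"
  by (simp add: sign_act_def mult.commute)

lemma sign_act_assoc: "sign_act (sign_act \<delta> \<epsilon>) x = sign_act \<delta> (sign_act \<epsilon> x)"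
  by (simp add: sign_act_def mult.assoc)

lemma sign_act_integer: "\<delta> \<in> signs \<Longrightarrow> x \<in> integer_points \<Longrightarrow> sign_act \<delta> x \<in> integer_points"
  unfolding integer_points_def sign_act_def signs_def mem_Collect_eq vec_lambda_beta
  by (intro allI Ints_mult) (metis Ints_1 Ints_minus insertE singletonD, blast)

lemma linear_sign_act: "linear (sign_act \<delta>)"
  by (intro linearI) (auto simp: sign_act_def vec_eq_iff algebra_simps)

lemma sign_act_orthant:
  assumes "\<delta> \<in> signs"
  shows "sign_act \<delta> x \<in> orthant (sign_act \<delta> \<epsilon>) \<longleftrightarrow> x \<in> orthant \<epsilon>"
proof -
  have "\<delta> $ i * \<epsilon> $ i * (\<delta> $ i * x $ i) = (\<delta> $ i * \<delta> $ i) * (\<epsilon> $ i * x $ i)" for i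
    by (simp add: mult_ac)
  then have "\<delta> $ i * \<epsilon> $ i * (\<delta> $ i * x $ i) = \<epsilon> $ i * x $ i" for i
    by (simp only: signs_square[OF assms] mult_1)
  then show ?thesis by (simp only: orthant_def sign_act_def mem_Collect_eq vec_lambda_beta)
qed

section \<open>Weighted counting by orthants\<close>

text \<open>This equals 2 to the number of vanishing coordinates of \<open>x\<close>.\<close>

definition orthant_count :: "real ^ 'n \<Rightarrow> nat" where
  "orthant_count x = card {\<epsilon>\<in>signs. x \<in> orthant \<epsilon>}"

lemma orthant_count_pos: "0 < orthant_count x"
proof -
  have "(\<chi> i. if x $ i < 0 then -1 else 1) \<in> {\<epsilon>\<in>signs. x \<in> orthant \<epsilon>}"
    by (auto simp: signs_def orthant_def)
  then show ?thesis unfolding orthant_count_def using finite_signs by (auto simp: card_gt_0_iff)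
qed

lemma orthant_count_sign_act:
  assumes "\<delta> \<in> signs"
  shows "orthant_count (sign_act \<delta> x) = orthant_count x"
proof -
  have "bij_betw (sign_act \<delta>) {\<epsilon>\<in>signs. x \<in> orthant \<epsilon>} {\<epsilon>\<in>signs. sign_act \<delta> x \<in> orthant \<epsilon>}"
  proof (rule bij_betw_byWitness[where f' = "sign_act \<delta>"])
    show "sign_act \<delta> ` {\<epsilon>\<in>signs. sign_act \<delta> x \<in> orthant \<epsilon>} \<subseteq> {\<epsilon>\<in>signs. x \<in> orthant \<epsilon>}"
      using assms sign_act_orthant[OF assms, of "sign_act \<delta> x"]
      by (auto simp: sign_act_signs sign_act_self)
  qed (use assms in \<open>auto simp: sign_act_self sign_act_signs sign_act_orthant\<close>)
  then show ?thesis by (simp add: orthant_count_def bij_betw_same_card)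
qed

text \<open>Points on the coordinate hyperplanes lie in several orthants, whence the weights.\<close>

lemma card_eq_sum_orthants:
  assumes "finite A"
  shows "real (card A) = (\<Sum>\<epsilon>\<in>signs. \<Sum>x\<in>A \<inter> orthant \<epsilon>. 1 / real (orthant_count x))"
proof -
  have "(\<Sum>\<epsilon>\<in>signs. \<Sum>x\<in>A \<inter> orthant \<epsilon>. 1 / real (orthant_count x)) =
    (\<Sum>\<epsilon>\<in>signs. \<Sum>x\<in>A. if x \<in> orthant \<epsilon> then 1 / real (orthant_count x) else 0)"
    using assms by (intro sum.cong refl sum.inter_restrict)
  also have "\<dots> = (\<Sum>x\<in>A. \<Sum>\<epsilon>\<in>signs. if x \<in> orthant \<epsilon> then 1 / real (orthant_count x) else 0)"
    by (rule sum.swap)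
  also have "\<dots> = (\<Sum>x\<in>A. \<Sum>\<epsilon>\<in>{\<epsilon>\<in>signs. x \<in> orthant \<epsilon>}. 1 / real (orthant_count x))"
    using finite_signs by (intro sum.cong refl sum.inter_filter[symmetric])
  also have "\<dots> = (\<Sum>x\<in>A. 1)"
  proof (intro sum.cong refl)
    fix x :: "real ^ 'n"
    show "(\<Sum>\<epsilon>\<in>{\<epsilon>\<in>signs. x \<in> orthant \<epsilon>}. 1 / real (orthant_count x)) = 1"
      using orthant_count_pos[of x] by (simp add: orthant_count_def)
  qed
  finally show ?thesis by simp
qed

text \<open>Sign changes permute the orthants transitively and preserve the weights, so all orthants
  contribute the same amount to \<open>card_eq_sum_orthants\<close>.\<close>

lemma card_sign_invariant:
  fixes A :: "(real ^ 'n) set"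
  assumes "finite A" and inv: "\<And>\<delta> x. \<delta> \<in> signs \<Longrightarrow> x \<in> A \<Longrightarrow> sign_act \<delta> x \<in> A" and \<epsilon>: "\<epsilon> \<in> signs"
  shows "real (card A) = 2 ^ CARD('n) * (\<Sum>x\<in>A \<inter> orthant \<epsilon>. 1 / real (orthant_count x))"
proof -
  have same: "(\<Sum>x\<in>A \<inter> orthant \<eta>. 1 / real (orthant_count x)) = (\<Sum>x\<in>A \<inter> orthant \<epsilon>. 1 / real (orthant_count x))"
    if \<eta>: "\<eta> \<in> signs" for \<eta>
  proof -
    \<comment> \<open>Every sign vector is its own inverse, so the product of the two exchanges
      them.\<close>
    define \<delta> where "\<delta> = sign_act \<epsilon> \<eta>"
    have \<delta>: "\<delta> \<in> signs" using \<epsilon> \<eta> by (simp add: \<delta>_def sign_act_signs)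
    have swap: "sign_act \<delta> \<epsilon> = \<eta>" "sign_act \<delta> \<eta> = \<epsilon>"
      using \<epsilon> \<eta> sign_act_self[OF \<eta>, of \<epsilon>] sign_act_self[OF \<epsilon>, of \<eta>]
      by (metis \<delta>_def sign_act_commute)+
    have "sign_act \<delta> x \<in> orthant \<epsilon>" if "x \<in> orthant \<eta>" for x
      using sign_act_orthant[OF \<delta>, of x \<eta>] that swap by simp
    moreover have "sign_act \<delta> x \<in> orthant \<eta>" if "x \<in> orthant \<epsilon>" for x
      using sign_act_orthant[OF \<delta>, of x \<epsilon>] that swap by simp
    ultimately show ?thesis
      using inv[OF \<delta>] orthant_count_sign_act[OF \<delta>] sign_act_self[OF \<delta>]
      by (intro sum.reindex_bij_witness[of _ "sign_act \<delta>" "sign_act \<delta>"]) auto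
  qed
  have "(\<Sum>\<eta>\<in>signs. \<Sum>x\<in>A \<inter> orthant \<eta>. 1 / real (orthant_count x)) =
    (\<Sum>\<eta>\<in>(signs :: (real ^ 'n) set). \<Sum>x\<in>A \<inter> orthant \<epsilon>. 1 / real (orthant_count x))"
    by (rule sum.cong[OF refl same])
  then show ?thesis
    using card_eq_sum_orthants[OF assms(1)] by (simp add: card_signs of_nat_power)
qed

section \<open>Symmetrized anti-blocking polytopes\<close>

text \<open>This replaces the choice of signs by absolute values, so that the anti-blocking property
  can be applied to coordinatewise inequalities.\<close>

lemma sym_hull_iff:
  assumes "P \<subseteq> {x. \<forall>i. 0 \<le> x $ i}"
  shows "x \<in> P\<^sup>\<plusminus> \<longleftrightarrow> (\<chi> i. \<bar>x $ i\<bar>) \<in> P"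
proof
  assume "x \<in> P\<^sup>\<plusminus>"
  then obtain \<epsilon> y where y: "\<epsilon> \<in> signs" "y \<in> P" "x = sign_act \<epsilon> y" by (auto simp: sym_hull_def)
  then have "(\<chi> i. \<bar>x $ i\<bar>) = y"
    using assms by (auto simp: vec_eq_iff sign_act_def abs_mult signs_iff_abs)
  then show "(\<chi> i. \<bar>x $ i\<bar>) \<in> P" using y by simp
next
  assume P: "(\<chi> i. \<bar>x $ i\<bar>) \<in> P"
  define \<epsilon> :: "real ^ 'a" where "\<epsilon> = (\<chi> i. if x $ i < 0 then -1 else 1)"
  have "\<epsilon> \<in> signs" "x = sign_act \<epsilon> (\<chi> i. \<bar>x $ i\<bar>)"
    by (auto simp: \<epsilon>_def signs_def sign_act_def vec_eq_iff)
  then show "x \<in> P\<^sup>\<plusminus>" using P unfolding sym_hull_def by blast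
qed

lemma sign_act_sym_hull: "\<delta> \<in> signs \<Longrightarrow> x \<in> P\<^sup>\<plusminus> \<Longrightarrow> sign_act \<delta> x \<in> P\<^sup>\<plusminus>"
  unfolding sym_hull_def mem_Collect_eq by (metis sign_act_signs sign_act_assoc)

lemma anti_blockingD:
  "anti_blocking P \<Longrightarrow> y \<in> P \<Longrightarrow> (\<And>i. 0 \<le> x $ i) \<Longrightarrow> (\<And>i. x $ i \<le> y $ i) \<Longrightarrow> x \<in> P"
  unfolding anti_blocking_def by blast

lemma
  assumes "anti_blocking P"
  shows anti_blocking_lattice: "lattice_polytope P" and anti_blocking_full: "full_dimensional P"
    and anti_blocking_nonneg: "P \<subseteq> {x. \<forall>i. 0 \<le> x $ i}" and anti_blocking_convex: "convex P"
proof -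
  show "lattice_polytope P" "full_dimensional P" "P \<subseteq> {x. \<forall>i. 0 \<le> x $ i}"
    using assms by (simp_all only: anti_blocking_def)
  then show "convex P" by (simp add: lattice_polytope_def polytope_imp_convex)
qed

text \<open>By the triangle inequality, the absolute values of a convex combination are dominated by
  the same combination of the absolute values, which lies in \<open>P\<close>.\<close>

lemma convex_sym_hull:
  assumes P: "anti_blocking P"
  shows "convex (P\<^sup>\<plusminus>)"
proof (rule convexI)
  fix x y :: "real ^ 'a" and u v :: real
  assume *: "x \<in> P\<^sup>\<plusminus>" "y \<in> P\<^sup>\<plusminus>" "0 \<le> u" "0 \<le> v" "u + v = 1"
  note nonneg = anti_blocking_nonneg[OF P] and conv = anti_blocking_convex[OF P]
  have mem: "u *\<^sub>R (\<chi> i. \<bar>x $ i\<bar>) + v *\<^sub>R (\<chi> i. \<bar>y $ i\<bar>) \<in> P"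
    using * by (intro convexD[OF conv]) (simp_all add: sym_hull_iff[OF nonneg])
  have le: "\<bar>(u *\<^sub>R x + v *\<^sub>R y) $ i\<bar> \<le> (u *\<^sub>R (\<chi> i. \<bar>x $ i\<bar>) + v *\<^sub>R (\<chi> i. \<bar>y $ i\<bar>)) $ i" for i
    using abs_triangle_ineq[of "u * x $ i" "v * y $ i"] *(3,4) by (simp add: abs_mult)
  have "(\<chi> i. \<bar>(u *\<^sub>R x + v *\<^sub>R y) $ i\<bar>) \<in> P"
    by (rule anti_blockingD[OF P mem]) (simp_all only: vec_lambda_beta abs_ge_zero le)
  then show "u *\<^sub>R x + v *\<^sub>R y \<in> P\<^sup>\<plusminus>" by (simp add: sym_hull_iff[OF nonneg])
qed

text \<open>All sign changes of the vertices of \<open>P\<close> serve as \<open>V\<close>. Integral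
  generators are enough for the Ehrhart theorem, so the vertices of the symmetrized set need not be
  determined.\<close>

lemma sym_hull_eq_convex_hull:
  assumes P: "anti_blocking P"
  obtains V where "finite V" "V \<subseteq> integer_points" "P\<^sup>\<plusminus> = convex hull V"
proof -
  define E where "E = {v. v extreme_point_of P}"
  have poly: "polytope P" and E_int: "E \<subseteq> integer_points"
    using anti_blocking_lattice[OF P] by (auto simp: lattice_polytope_def E_def)
  have P_eq: "P = convex hull E"
    unfolding E_def using poly polytope_imp_compact polytope_imp_convex by (intro Krein_Milman_Minkowski)
  have "finite E"
    unfolding E_def using poly by (intro finite_polyhedron_extreme_points polytope_imp_polyhedron)
  define V where "V = (\<Union>\<epsilon>\<in>signs. sign_act \<epsilon> ` E)"
  have "P\<^sup>\<plusminus> = convex hull V"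
  proof (intro subset_antisym)
    have "sign_act \<epsilon> ` P \<subseteq> convex hull V" if "\<epsilon> \<in> signs" for \<epsilon>
      unfolding P_eq convex_hull_linear_image[OF linear_sign_act]
      using that by (intro hull_mono) (auto simp: V_def)
    then show "P\<^sup>\<plusminus> \<subseteq> convex hull V" by (auto simp: sym_hull_def)
    have "E \<subseteq> P" by (subst P_eq) (rule hull_subset)
    then have "V \<subseteq> P\<^sup>\<plusminus>" by (auto simp: V_def sym_hull_def)
    then show "convex hull V \<subseteq> P\<^sup>\<plusminus>" by (intro hull_minimal convex_sym_hull[OF P])
  qed
  moreover have "finite V" using \<open>finite E\<close> by (simp add: V_def finite_signs)
  moreover have "V \<subseteq> integer_points" using E_int sign_act_integer by (auto simp: V_def)
  ultimately show ?thesis using that by blast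
qed

lemma zero_interior_sym_hull:
  fixes P :: "(real ^ 'n) set"
  assumes P: "anti_blocking P"
  shows "0 \<in> interior (P\<^sup>\<plusminus>)"
proof -
  note nonneg = anti_blocking_nonneg[OF P] and conv = anti_blocking_convex[OF P]
  have full: "aff_dim P = int DIM(real ^ 'n)"
    using anti_blocking_full[OF P] by (simp add: full_dimensional_def)
  have "P \<noteq> {}" using full by auto
  moreover have "affine hull P = UNIV" using full aff_dim_eq_full by blast
  ultimately obtain y where y: "y \<in> interior P"
    using conv rel_interior_interior[of P] rel_interior_eq_empty[OF conv] by blast
  \<comment> \<open>Moving an interior point slightly along the all-ones vector gives a point of
    \<open>P\<close> with all coordinates at least \<open>e\<close>; by anti-blocking it dominates a
    neighbourhood of the origin.\<close>
  have "((\<lambda>e. y + e *\<^sub>R (\<chi> i. 1)) \<longlongrightarrow> y + 0 *\<^sub>R (\<chi> i. 1)) (at_right (0::real))"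
    by (intro tendsto_intros)
  then have "\<forall>\<^sub>F e in at_right (0::real). y + e *\<^sub>R (\<chi> i. 1) \<in> interior P"
    by (rule topological_tendstoD) (use y in auto)
  moreover have "\<forall>\<^sub>F e in at_right (0::real). 0 < e" by (rule eventually_at_right_less)
  ultimately have "\<forall>\<^sub>F e in at_right (0::real). y + e *\<^sub>R (\<chi> i. 1) \<in> interior P \<and> 0 < e"
    by (rule eventually_conj)
  then obtain e where e: "y + e *\<^sub>R (\<chi> i. 1) \<in> P" "0 < e"
    using eventually_happens interior_subset trivial_limit_at_right_real by blast
  have "ball 0 e \<subseteq> P\<^sup>\<plusminus>"
  proof
    fix x :: "real ^ 'n" assume "x \<in> ball 0 e"
    then have "\<bar>x $ i\<bar> \<le> e" for i using component_le_norm_cart[of x i] by simp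
    moreover have "0 \<le> y $ i" for i using y interior_subset[of P] nonneg by blast
    ultimately have "\<bar>x $ i\<bar> \<le> (y + e *\<^sub>R (\<chi> i. 1)) $ i" for i
      using add_mono[of 0 "y $ i" "\<bar>x $ i\<bar>" e] by simp
    then have "(\<chi> i. \<bar>x $ i\<bar>) \<in> P"
      using anti_blockingD[OF P e(1), of "\<chi> i. \<bar>x $ i\<bar>"] by simp
    then show "x \<in> P\<^sup>\<plusminus>" by (simp add: sym_hull_iff[OF nonneg])
  qed
  then show ?thesis using e(2) by (auto simp: mem_interior)
qed

text \<open>The exact degree and the positive leading coefficient are recorded because
  palindromicity and \<gamma>-expansions refer to the degree.\<close>

lemma h_star_sym_hull:
  fixes P :: "(real ^ 'n) set"
  assumes P: "anti_blocking P"
  shows "ehrhart_series (P\<^sup>\<plusminus>) * (1 - fps_X) ^ (CARD('n) + 1) = fps_of_poly (h_star (P\<^sup>\<plusminus>))"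
    and "degree (h_star (P\<^sup>\<plusminus>)) = CARD('n)" and "0 < lead_coeff (h_star (P\<^sup>\<plusminus>))"
proof -
  note int = zero_interior_sym_hull[OF P]
  obtain V where V: "finite V" "V \<subseteq> integer_points" "P\<^sup>\<plusminus> = convex hull V"
    by (rule sym_hull_eq_convex_hull[OF P])
  obtain h where h: "ehrhart_series (P\<^sup>\<plusminus>) * (1 - fps_X) ^ (CARD('n) + 1) = fps_of_poly h"
    "degree h = CARD('n)" "0 < lead_coeff h"
    using ehrhart_interior_lattice_point[OF V(1,2)] int unfolding V(3) by blast
  have "full_dimensional (P\<^sup>\<plusminus>)"
    using int aff_dim_nonempty_interior[of "P\<^sup>\<plusminus>"] by (auto simp: full_dimensional_def)
  then have "h_star (P\<^sup>\<plusminus>) = h" using h(1) by (rule h_star_eqI)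
  then show "ehrhart_series (P\<^sup>\<plusminus>) * (1 - fps_X) ^ (CARD('n) + 1) = fps_of_poly (h_star (P\<^sup>\<plusminus>))"
    "degree (h_star (P\<^sup>\<plusminus>)) = CARD('n)" "0 < lead_coeff (h_star (P\<^sup>\<plusminus>))"
    using h by simp_all
qed

section \<open>Averaging over the orthants\<close>

lemma dilate_orthant:
  assumes "0 < m"
  shows "(*\<^sub>R) m ` S \<inter> orthant \<epsilon> = (*\<^sub>R) m ` (S \<inter> orthant \<epsilon>)"
proof -
  have "m *\<^sub>R x \<in> orthant \<epsilon> \<longleftrightarrow> x \<in> orthant \<epsilon>" for x
  proof -
    have "0 \<le> \<epsilon> $ i * (m * x $ i) \<longleftrightarrow> 0 \<le> \<epsilon> $ i * x $ i" for i
      using assms by (simp add: mult.left_commute[of _ m] zero_le_mult_iff[of m])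
    then show ?thesis by (simp add: orthant_def)
  qed
  then show ?thesis by auto
qed

text \<open>In the orthant of \<epsilon>, the dilates of \<open>P\<close> and of the symmetrized
  \<open>P_at \<epsilon>\<close> have the same weighted count. By symmetry this is the full count of
  the latter divided by \<open>2 ^ CARD('n)\<close>.\<close>

lemma ehrhart_series_average:
  fixes P :: "(real ^ 'n) set" and P_at :: "real ^ 'n \<Rightarrow> (real ^ 'n) set"
  assumes "bounded P" and ab: "\<And>\<epsilon>. \<epsilon> \<in> signs \<Longrightarrow> anti_blocking (P_at \<epsilon>)"
    and eq: "\<And>\<epsilon>. \<epsilon> \<in> signs \<Longrightarrow> P \<inter> orthant \<epsilon> = (P_at \<epsilon>)\<^sup>\<plusminus> \<inter> orthant \<epsilon>"
  shows "fps_const (2 ^ CARD('n)) * ehrhart_series P = (\<Sum>\<epsilon>\<in>signs. ehrhart_series ((P_at \<epsilon>)\<^sup>\<plusminus>))"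
proof (rule fps_ext)
  fix m
  show "fps_nth (fps_const (2 ^ CARD('n)) * ehrhart_series P) m =
    fps_nth (\<Sum>\<epsilon>\<in>signs. ehrhart_series ((P_at \<epsilon>)\<^sup>\<plusminus>)) m"
  proof (cases "m = 0")
    case True
    \<comment> \<open>Every constant term is one by convention, so both sides equal the number of
      sign vectors.\<close>
    then show ?thesis by (simp add: ehrhart_series_def fps_sum_nth card_signs)
  next
    case False
    define D where "D S = (*\<^sub>R) (real m) ` S \<inter> integer_points" for S :: "(real ^ 'n) set"
    have fin: "finite (D S)" if "bounded S" for S
      unfolding D_def using that by (intro finite_bounded_integer_points bounded_scaling)
    have "2 ^ CARD('n) * (\<Sum>x\<in>D P \<inter> orthant \<epsilon>. 1 / real (orthant_count x)) =
      real (card (D ((P_at \<epsilon>)\<^sup>\<plusminus>)))" if \<epsilon>: "\<epsilon> \<in> signs" for \<epsilon>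
    proof -
      obtain V where "finite V" "(P_at \<epsilon>)\<^sup>\<plusminus> = convex hull V"
        using sym_hull_eq_convex_hull[OF ab[OF \<epsilon>]] by metis
      then have "bounded ((P_at \<epsilon>)\<^sup>\<plusminus>)" by (simp add: bounded_convex_hull finite_imp_bounded)
      then have fin': "finite (D ((P_at \<epsilon>)\<^sup>\<plusminus>))" by (rule fin)
      have inv: "sign_act \<delta> x \<in> D ((P_at \<epsilon>)\<^sup>\<plusminus>)" if \<delta>: "\<delta> \<in> signs" and x: "x \<in> D ((P_at \<epsilon>)\<^sup>\<plusminus>)" for \<delta> x
      proof -
        obtain y where y: "y \<in> (P_at \<epsilon>)\<^sup>\<plusminus>" "x = real m *\<^sub>R y" "x \<in> integer_points"
          using x by (auto simp: D_def)
        then have "sign_act \<delta> x = real m *\<^sub>R sign_act \<delta> y"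
          by (simp add: linear_scale[OF linear_sign_act])
        then show ?thesis
          unfolding D_def using sign_act_sym_hull[OF \<delta> y(1)] sign_act_integer[OF \<delta> y(3)] by blast
      qed
      \<comment> \<open>Dilation commutes with restriction to an orthant, so the hypothesis on
        \<open>P\<close> passes to its dilates.\<close>
      have "D S \<inter> orthant \<epsilon> = (*\<^sub>R) (real m) ` (S \<inter> orthant \<epsilon>) \<inter> integer_points" for S
        using dilate_orthant[of "real m" S \<epsilon>] False by (auto simp: D_def)
      then have "D P \<inter> orthant \<epsilon> = D ((P_at \<epsilon>)\<^sup>\<plusminus>) \<inter> orthant \<epsilon>"
        by (simp only: eq[OF \<epsilon>])
      then show ?thesis using card_sign_invariant[OF fin' inv \<epsilon>] by simp
    qed
    then have "2 ^ CARD('n) * real (card (D P)) = (\<Sum>\<epsilon>\<in>signs. real (card (D ((P_at \<epsilon>)\<^sup>\<plusminus>))))"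
      unfolding card_eq_sum_orthants[OF fin[OF assms(1)]] sum_distrib_left by (intro sum.cong) auto
    then show ?thesis using False by (simp add: ehrhart_series_def D_def fps_sum_nth)
  qed
qed

text \<open>Equal degrees and positive leading coefficients prevent cancellation at the top, so the
  sum again has degree \<open>d\<close>. Reflection and the \<gamma>-basis are then the same for all
  summands and can be treated linearly.\<close>

lemma gamma_positive_average:
  fixes f :: "'b \<Rightarrow> real poly"
  assumes "finite I" "I \<noteq> {}" "0 < c"
    and gamma: "\<And>i. i \<in> I \<Longrightarrow> gamma_positive (f i)"
    and deg: "\<And>i. i \<in> I \<Longrightarrow> degree (f i) = d" and lead: "\<And>i. i \<in> I \<Longrightarrow> 0 < lead_coeff (f i)"
  shows "gamma_positive (smult c (\<Sum>i\<in>I. f i))"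
proof -
  define F where "F = smult c (\<Sum>i\<in>I. f i)"
  have coeff: "coeff F n = c * (\<Sum>i\<in>I. coeff (f i) n)" for n by (simp add: F_def coeff_sum)
  have "degree F \<le> d"
    unfolding F_def using deg by (intro order_trans[OF degree_smult_le] degree_sum_le assms(1)) auto
  moreover have "0 < coeff F d"
    unfolding coeff using assms(1-3) deg lead by (auto intro!: mult_pos_pos sum_pos)
  ultimately have deg_F: "degree F = d" using le_degree[of F d] by auto
  have "reflect_poly F = F"
  proof (rule poly_eqI)
    fix n
    have "coeff (reflect_poly F) n = c * (\<Sum>i\<in>I. coeff (reflect_poly (f i)) n)"
      by (simp add: coeff_reflect_poly deg_F coeff deg)
    also have "\<dots> = coeff F n"
      using gamma by (simp add: coeff gamma_positive_def)
    finally show "coeff (reflect_poly F) n = coeff F n" .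
  qed
  moreover have "\<exists>\<gamma>. (\<forall>k \<le> d div 2. 0 \<le> \<gamma> k) \<and>
      F = (\<Sum>k \<le> d div 2. smult (\<gamma> k) (monom 1 k * [:1, 1:] ^ (d - 2 * k)))"
  proof -
    have "\<exists>\<gamma> :: nat \<Rightarrow> real. (\<forall>k \<le> d div 2. 0 \<le> \<gamma> k) \<and>
      f i = (\<Sum>k \<le> d div 2. smult (\<gamma> k) (monom 1 k * [:1, 1:] ^ (d - 2 * k)))" if "i \<in> I" for i
      using gamma[OF that] unfolding gamma_positive_def deg[OF that] by blast
    then have "\<forall>i\<in>I. \<exists>\<gamma> :: nat \<Rightarrow> real. (\<forall>k \<le> d div 2. 0 \<le> \<gamma> k) \<and>
      f i = (\<Sum>k \<le> d div 2. smult (\<gamma> k) (monom 1 k * [:1, 1:] ^ (d - 2 * k)))"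
      by (rule ballI)
    from bchoice[OF this] obtain g :: "'b \<Rightarrow> nat \<Rightarrow> real" where g: "\<And>i k. i \<in> I \<Longrightarrow> k \<le> d div 2 \<Longrightarrow> 0 \<le> g i k"
      "\<And>i. i \<in> I \<Longrightarrow> f i = (\<Sum>k \<le> d div 2. smult (g i k) (monom 1 k * [:1, 1:] ^ (d - 2 * k)))"
      by blast
    have "F = smult c (\<Sum>i\<in>I. \<Sum>k \<le> d div 2. smult (g i k) (monom 1 k * [:1, 1:] ^ (d - 2 * k)))"
      unfolding F_def using g(2) by (intro arg_cong[of _ _ "smult c"] sum.cong) auto
    also have "\<dots> = (\<Sum>k \<le> d div 2. smult (c * (\<Sum>i\<in>I. g i k)) (monom 1 k * [:1, 1:] ^ (d - 2 * k)))"
      by (subst sum.swap, intro poly_eqI)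
         (simp add: coeff_sum sum_distrib_left sum_distrib_right mult.assoc)
    finally show ?thesis
      using g(1) \<open>0 < c\<close> by (intro exI[of _ "\<lambda>k. c * (\<Sum>i\<in>I. g i k)"]) (auto intro!: mult_nonneg_nonneg sum_nonneg)
  qed
  ultimately show ?thesis by (simp add: gamma_positive_def F_def[symmetric] deg_F)
qed

theorem theorem0p1:
  fixes P :: "(real ^ 'n) set"
    and P_at :: "real ^ 'n \<Rightarrow> (real ^ 'n) set"
  assumes "locally_anti_blocking P"
    and "\<And>\<epsilon>. \<epsilon> \<in> signs \<Longrightarrow> anti_blocking (P_at \<epsilon>)"
    and "\<And>\<epsilon>. \<epsilon> \<in> signs \<Longrightarrow> P \<inter> orthant \<epsilon> = (P_at \<epsilon>)\<^sup>\<plusminus> \<inter> orthant \<epsilon>"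
  shows "h_star P = smult (1 / 2 ^ CARD('n)) (\<Sum>\<epsilon>\<in>signs. h_star ((P_at \<epsilon>)\<^sup>\<plusminus>)) \<and>
    ((\<forall>\<epsilon>\<in>signs. gamma_positive (h_star ((P_at \<epsilon>)\<^sup>\<plusminus>))) \<longrightarrow> gamma_positive (h_star P))"
proof -
  define H where "H = smult (1 / 2 ^ CARD('n)) (\<Sum>\<epsilon>\<in>signs. h_star ((P_at \<epsilon>)\<^sup>\<plusminus>))"
  have "bounded P" and full: "full_dimensional P"
    using assms(1) by (auto simp: locally_anti_blocking_def lattice_polytope_def polytope_imp_bounded)
  define C where "C = (2 :: real) ^ CARD('n)"
  have "C \<noteq> 0" by (simp add: C_def)
  have "fps_const C * ehrhart_series P = (\<Sum>\<epsilon>\<in>signs. ehrhart_series ((P_at \<epsilon>)\<^sup>\<plusminus>))"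
    unfolding C_def by (rule ehrhart_series_average[OF \<open>bounded P\<close> assms(2,3)])
  \<comment> \<open>All the polytopes have dimension \<open>CARD('n)\<close>, so one power of
    \<open>1 - fps_X\<close> clears every denominator.\<close>
  then have "fps_const C * (ehrhart_series P * (1 - fps_X) ^ (CARD('n) + 1)) =
      (\<Sum>\<epsilon>\<in>signs. ehrhart_series ((P_at \<epsilon>)\<^sup>\<plusminus>) * (1 - fps_X) ^ (CARD('n) + 1))"
    by (metis (no_types, lifting) mult.assoc sum.cong sum_distrib_right)
  also have "\<dots> = fps_of_poly (\<Sum>\<epsilon>\<in>signs. h_star ((P_at \<epsilon>)\<^sup>\<plusminus>))"
    unfolding fps_of_poly_sum using h_star_sym_hull(1)[OF assms(2)] by (intro sum.cong) auto
  also have "\<dots> = fps_const C * fps_of_poly H"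
    using \<open>C \<noteq> 0\<close> by (simp add: H_def C_def flip: fps_of_poly_smult)
  finally have "ehrhart_series P * (1 - fps_X) ^ (CARD('n) + 1) = fps_of_poly H"
    using \<open>C \<noteq> 0\<close> by (metis fps_const_eq_0_iff mult_left_cancel)
  \<comment> \<open>The average solves the defining equation for \<open>P\<close>, which also gives
    the existence of its \<open>h_star\<close> without any interior lattice point of
    \<open>P\<close>.\<close>
  then have H: "h_star P = H" by (rule h_star_eqI[OF full])
  have "signs \<noteq> ({} :: (real ^ 'n) set)" using card_signs[where 'n = 'n] by force
  then have "gamma_positive H" if "\<forall>\<epsilon>\<in>signs. gamma_positive (h_star ((P_at \<epsilon>)\<^sup>\<plusminus>))"
    unfolding H_def using that h_star_sym_hull(2,3) assms(2)
    by (intro gamma_positive_average[where d = "CARD('n)"] finite_signs) auto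
  then show ?thesis unfolding H by (simp add: H_def)
qed

end
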